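(* Let $d\ge 2$ be an integer, and let $p$ be such that either $p\in(2^\#,2^* )$, or $p=2^*$ if $d\ge3$. Then there exists a positive function $\rho_0$ on $\mathbb{S}^d$ such that, if $\rho$ is the solution of the heat equation $\frac{\partial\rho}{\partial t}=\Delta\rho$ on $\mathbb{S}^d$ with initial datum $\rho(t=0,\cdot)=\rho_0$, then \[ \frac{d}{dt}\Big(\mathcal I_p[\rho]-d\,\mathcal E_p[\rho]\Big)_{|t=0}>0\,. \]
   Context: $\Delta$ is the Laplace-Beltrami operator on the unit sphere $\mathbb{S}^d\subset\mathbb{R}^{d+1}$ and $d\mu$ is the uniform probability measure on $\mathbb{S}^d$. The exponents are $2^\#:=\frac{2d^2+1}{(d-1)^2}$ and $2^*:=\frac{2d}{d-2}$ if $d\ge3$, $2^*:=+\infty$ if $d=2$. For $\rho>0$ and $p\neq2$, \[ \mathcal E_p[\rho]:=\frac1{p-2}\left[\left(\int_{\mathbb{S}^d}\rho\,d\mu\right)^{2/p}-\int_{\mathbb{S}^d}\rho^{2/p}\,d\mu\right],\qquad \mathcal I_p[\rho]:=\int_{\mathbb{S}^d}|\nabla\rho^{1/p}|^2\,d\mu\,. \] *)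

theory Defs
  imports "HOL-Probability.Probability"
begin

text \<open>
  The sphere is the set \<open>sphere 0 1\<close> in a Euclidean space of dimension \<open>d + 1\<close>. Functions and
  tangent fields on it are represented by functions on the ambient space of which only the values
  on \<open>sphere 0 1\<close> matter: every notion below depends on \<open>f\<close> only through the \<open>0\<close>-homogeneous
  extension \<open>\<lambda>y. f (sgn y)\<close>, where \<open>sgn y = y /\<^sub>R norm y\<close>, or through integrals over the sphere.
\<close>

text \<open>
  The uniform probability measure: the image of the uniform distribution on the unit ball under
  the radial projection. The centre, which \<open>sgn\<close> maps to \<open>0\<close>, is a null set.
\<close>

definition sphere_measure :: "'a::euclidean_space measure" where
  "sphere_measure =
     restrict_space (distr (uniform_measure lborel (ball 0 1)) borel sgn) (sphere 0 1)"

lemma space_sphere_measure [simp]: "space sphere_measure = sphere 0 1"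
  by (simp add: sphere_measure_def space_restrict_space)

lemma prob_space_sphere_measure: "prob_space (sphere_measure :: 'a::euclidean_space measure)"
proof -
  let ?B = "ball 0 1 :: 'a set"
  have B: "emeasure lborel ?B \<noteq> 0" "emeasure lborel ?B \<noteq> \<infinity>"
    using unit_ball_vol_pos[of "real DIM('a)", OF of_nat_0_le_iff]
    by (auto simp: emeasure_ball simp del: unit_ball_vol_pos)
  interpret U: prob_space "uniform_measure lborel ?B"
    by (rule prob_space_uniform_measure[OF B])
  have s[measurable]: "(sgn :: 'a \<Rightarrow> 'a) \<in> borel_measurable borel"
    unfolding sgn_div_norm by measurable
  have "AE y in lborel. y \<noteq> (0::'a)"
    by (rule AE_lborel_singleton)
  then have "AE y in uniform_measure lborel ?B. sgn y \<in> sphere 0 1"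
    by (intro AE_uniform_measureI) (auto simp: norm_sgn)
  then have "emeasure (uniform_measure lborel ?B) (sgn -` sphere 0 1) = 1"
    by (subst U.emeasure_eq_1_AE) (auto intro: measurable_sets_borel[OF s])
  moreover have "emeasure (sphere_measure :: 'a measure) (sphere 0 1)
      = emeasure (uniform_measure lborel ?B) (sgn -` sphere 0 1)"
    unfolding sphere_measure_def
    by (subst emeasure_restrict_space) (auto simp: emeasure_distr)
  ultimately show ?thesis
    by (intro prob_spaceI) simp
qed

text \<open>
  The \<open>0\<close>-homogeneous extension has no radial derivative, so at a point of the sphere its Euclidean
  gradient is tangent and is the Riemannian gradient, and the Euclidean trace of the derivative of
  an extended tangent field is the trace over the tangent space, i.e. the Riemannian divergence.
\<close>

definition sphere_grad :: "('a::euclidean_space \<Rightarrow> real) \<Rightarrow> 'a \<Rightarrow> 'a" where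
  "sphere_grad f x = (\<Sum>b\<in>Basis. frechet_derivative (\<lambda>y. f (sgn y)) (at x) b *\<^sub>R b)"

definition sphere_div :: "('a::euclidean_space \<Rightarrow> 'a) \<Rightarrow> 'a \<Rightarrow> real" where
  "sphere_div X x = (\<Sum>b\<in>Basis. frechet_derivative (\<lambda>y. X (sgn y)) (at x) b \<bullet> b)"

definition laplace_beltrami :: "('a::euclidean_space \<Rightarrow> real) \<Rightarrow> 'a \<Rightarrow> real" where
  "laplace_beltrami f = sphere_div (sphere_grad f)"

text \<open>\<open>C_on k U f\<close>: on the open set \<open>U\<close>, \<open>f\<close> is \<open>k\<close> times continuously differentiable.\<close>

primrec C_on :: "nat \<Rightarrow> 'a::euclidean_space set \<Rightarrow> ('a \<Rightarrow> real) \<Rightarrow> bool" where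
  "C_on 0 U f \<longleftrightarrow> continuous_on U f"
| "C_on (Suc k) U f \<longleftrightarrow> (\<forall>x\<in>U. f differentiable (at x)) \<and>
     (\<forall>b\<in>Basis. C_on k U (\<lambda>x. frechet_derivative f (at x) b))"

definition C_sphere :: "nat \<Rightarrow> ('a::euclidean_space \<Rightarrow> real) \<Rightarrow> bool" where
  "C_sphere k f \<longleftrightarrow> C_on k (- {0}) (\<lambda>y. f (sgn y))"

definition smooth_sphere :: "('a::euclidean_space \<Rightarrow> real) \<Rightarrow> bool" where
  "smooth_sphere f \<longleftrightarrow> (\<forall>k. C_sphere k f)"

text \<open>Classical solutions of the heat equation on the sphere for times \<open>t \<ge> 0\<close>.\<close>

definition heat_solution ::
    "('a::euclidean_space \<Rightarrow> real) \<Rightarrow> (real \<Rightarrow> 'a \<Rightarrow> real) \<Rightarrow> bool" where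
  "heat_solution \<rho>0 \<rho> \<longleftrightarrow>
     continuous_on ({0..} \<times> sphere 0 1) (\<lambda>(t, x). \<rho> t x) \<and>
     (\<forall>x\<in>sphere 0 1. \<rho> 0 x = \<rho>0 x) \<and>
     (\<forall>t>0. C_sphere 2 (\<rho> t) \<and>
        (\<forall>x\<in>sphere 0 1. ((\<lambda>s. \<rho> s x) has_real_derivative laplace_beltrami (\<rho> t) x) (at t)))"

definition two_sharp :: "nat \<Rightarrow> real" where
  "two_sharp d = (2 * (real d)^2 + 1) / (real d - 1)^2"

text \<open>Only used for \<open>d \<ge> 2\<close>.\<close>

definition two_star :: "nat \<Rightarrow> ereal" where
  "two_star d = (if d \<ge> 3 then ereal (2 * real d / (real d - 2)) else \<infinity>)"

definition entropy :: "real \<Rightarrow> ('a::euclidean_space \<Rightarrow> real) \<Rightarrow> real" where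
  "entropy p \<rho> = 1 / (p - 2) *
     ((\<integral>x. \<rho> x \<partial>sphere_measure) powr (2 / p) - (\<integral>x. \<rho> x powr (2 / p) \<partial>sphere_measure))"

definition fisher :: "real \<Rightarrow> ('a::euclidean_space \<Rightarrow> real) \<Rightarrow> real" where
  "fisher p \<rho> = (\<integral>x. (norm (sphere_grad (\<lambda>y. \<rho> y powr (1 / p)) x))^2 \<partial>sphere_measure)"

end

theory Submission
  imports Defs
begin

text \<open>
  Write \<open>z = x \<bullet> e\<close> for a unit vector \<open>e\<close>, \<open>\<nu> = 1 - z\<^sup>2\<close>, \<open>a = 2 / p\<close>, and for a zonal density
  \<open>\<rho>\<close> put \<open>r = \<rho>' / \<rho>\<close>, \<open>s = \<rho>'' / \<rho>\<close>. Along the heat flow, integrations by parts turn the derivative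
  of \<open>\<I>\<^sub>p - d \<E>\<^sub>p\<close> into \<open>- a\<^sup>2 / 2\<close> times the integral of \<open>\<nu>\<^sup>2 \<rho>\<^sup>a (s\<^sup>2 - 2 \<beta> s r\<^sup>2 + \<gamma> r\<^sup>4)\<close>, with
  \<open>\<beta> = (2 - a) (2 d + 1) / (2 (d + 2))\<close> and \<open>\<gamma> = d (2 - a) (3 - a) / (2 (d + 2))\<close>. The quadratic form in
  \<open>(s, r\<^sup>2)\<close> is indefinite exactly when \<open>p > 2\<^sup>#\<close>, and is then negative for \<open>s\<close> close to \<open>\<beta> r\<^sup>2\<close>. This
  holds everywhere on the sphere for \<open>\<rho>0 = 1 + \<epsilon> z + \<beta> / 2 (\<epsilon> z)\<^sup>2\<close> with \<open>\<epsilon>\<close> small. As \<open>\<rho>0\<close> is a sum of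
  spherical harmonics of degree at most 2, its heat flow is explicit, and it is the only classical
  solution by the maximum principle.
\<close>

section \<open>Rotation invariance and integration by parts\<close>

lemma borel_measurable_sgn [measurable]: "(sgn :: 'a::euclidean_space \<Rightarrow> 'a) \<in> borel_measurable borel"
  unfolding sgn_div_norm by measurable

text \<open>
  Weil's uniqueness argument for Haar measure: the measure of \<open>A\<close> times that of the unit ball \<open>B\<close> is a
  double integral, in which translations exchange the roles of \<open>A\<close> and \<open>B\<close>; and \<open>T\<close> preserves \<open>B\<close>.
\<close>

lemma lborel_distr_orthogonal_transformation:
  fixes T :: "'a::euclidean_space \<Rightarrow> 'a"
  assumes "orthogonal_transformation T"
  shows "distr lborel borel T = lborel"
proof (rule measure_eqI)
  have lin: "linear T" and nT: "norm (T x) = norm x" for x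
    using assms by (auto simp: orthogonal_transformation)
  have [measurable]: "T \<in> borel_measurable borel"
    using lin by (intro borel_measurable_continuous_onI linear_continuous_on)
      (simp add: linear_conv_bounded_linear)
  show "sets (distr lborel borel T) = sets lborel" by simp
  fix A :: "'a set" assume "A \<in> sets (distr lborel borel T)"
  then have A[measurable]: "A \<in> sets borel" by simp
  define B :: "'a set" where "B = ball 0 1"
  have [measurable]: "B \<in> sets borel" by (simp add: B_def)
  have trans: "(\<integral>\<^sup>+x. f (c + x) \<partial>lborel) = (\<integral>\<^sup>+x. f x \<partial>lborel)"
    if [measurable]: "f \<in> borel_measurable borel" for f and c :: 'a
    using nn_integral_distr[of "(+) c" lborel borel f] by (simp add: lborel_distr_plus)
  obtain T' where T': "T (T' x) = x" for x
    using orthogonal_transformation_surj[OF assms] by (metis surjD)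
  have B01: "emeasure lborel B \<noteq> 0" "emeasure lborel B \<noteq> \<infinity>"
    using unit_ball_vol_pos[of "real DIM('a)", OF of_nat_0_le_iff]
    by (auto simp: B_def emeasure_ball simp del: unit_ball_vol_pos)
  have "emeasure lborel A * emeasure lborel B
      = (\<integral>\<^sup>+y. (\<integral>\<^sup>+x. indicator A x * indicator B (T y) \<partial>lborel) \<partial>lborel)"
  proof -
    have "(\<integral>\<^sup>+y. indicator B (T y) \<partial>lborel) = (\<integral>\<^sup>+y. indicator B y \<partial>lborel)"
      by (intro nn_integral_cong) (simp add: indicator_def B_def nT)
    then show ?thesis
      by (simp add: nn_integral_multc nn_integral_cmult)
  qed
  also have "\<dots> = (\<integral>\<^sup>+y. (\<integral>\<^sup>+x. indicator A (T y + x) * indicator B (T y) \<partial>lborel) \<partial>lborel)"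
    by (intro nn_integral_cong trans[symmetric]) measurable
  also have "\<dots> = (\<integral>\<^sup>+x. (\<integral>\<^sup>+y. indicator A (T y + x) * indicator B (T y) \<partial>lborel) \<partial>lborel)"
    by (rule lborel_pair.Fubini') measurable
  \<comment> \<open>Here \<open>y\<close> is shifted by \<open>T' (-x)\<close>, which
    \<open>T\<close> maps to \<open>-x\<close>; surjectivity thus lets a translation on the image
    side be undone on the argument side.\<close>
  also have "\<dots> = (\<integral>\<^sup>+x. (\<integral>\<^sup>+y. indicator A (T y) * indicator B (T y - x) \<partial>lborel) \<partial>lborel)"
  proof (rule nn_integral_cong)
    fix x
    have "(\<integral>\<^sup>+y. indicator A (T y + x) * indicator B (T y) \<partial>lborel)
       = (\<integral>\<^sup>+y. indicator A (T (T' (-x) + y) + x) * indicator B (T (T' (-x) + y)) \<partial>lborel)"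
      by (rule trans[symmetric]) measurable
    then show "(\<integral>\<^sup>+y. indicator A (T y + x) * indicator B (T y) \<partial>lborel)
       = (\<integral>\<^sup>+y. indicator A (T y) * indicator B (T y - x) \<partial>lborel)"
      by (simp add: linear_add[OF lin] T')
  qed
  also have "\<dots> = (\<integral>\<^sup>+y. (\<integral>\<^sup>+x. indicator A (T y) * indicator B (T y - x) \<partial>lborel) \<partial>lborel)"
    by (rule lborel_pair.Fubini'[symmetric]) measurable
  \<comment> \<open>Shifting \<open>x\<close> by \<open>T y\<close> leaves the indicator of
    \<open>-B\<close>, and the ball is symmetric.\<close>
  also have "\<dots> = (\<integral>\<^sup>+y. indicator A (T y) * emeasure lborel B \<partial>lborel)"
  proof (rule nn_integral_cong)
    fix y
    have "(\<integral>\<^sup>+x. indicator B (T y - x) \<partial>lborel) = (\<integral>\<^sup>+x. indicator B (T y - (T y + x)) \<partial>lborel)"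
      by (rule trans[symmetric]) measurable
    also have "\<dots> = (\<integral>\<^sup>+x. indicator B x \<partial>lborel)"
      by (intro nn_integral_cong) (simp add: indicator_def B_def)
    finally show "(\<integral>\<^sup>+x. indicator A (T y) * indicator B (T y - x) \<partial>lborel)
        = indicator A (T y) * emeasure lborel B"
      by (subst nn_integral_cmult) auto
  qed
  also have "\<dots> = emeasure (distr lborel borel T) A * emeasure lborel B"
    by (subst nn_integral_multc) (auto simp: nn_integral_distr simp flip: nn_integral_indicator)
  finally show "emeasure (distr lborel borel T) A = emeasure lborel A"
    using B01 by (metis mult_divide_eq_ennreal infinity_ennreal_def)
qed

section \<open>Integrals of continuous functions over the sphere\<close>

lemma sets_sphere_measure: "sets (sphere_measure :: 'a::euclidean_space measure) = sets (restrict_space borel (sphere 0 1))"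
  unfolding sphere_measure_def by (rule sets_restrict_space_cong) simp

lemma integrable_sphere_measure:
  fixes f :: "'a::euclidean_space \<Rightarrow> real"
  assumes "continuous_on (sphere 0 1) f"
  shows "integrable sphere_measure f"
proof -
  interpret prob_space "sphere_measure :: 'a measure" by (rule prob_space_sphere_measure)
  have "f \<in> borel_measurable sphere_measure"
    using borel_measurable_continuous_on_restrict[OF assms] measurable_cong_sets[OF sets_sphere_measure refl]
    by blast
  moreover have "compact (f ` sphere 0 1)"
    using assms by (intro compact_continuous_image) auto
  then obtain K where "\<forall>x\<in>sphere 0 1. norm (f x) \<le> K"
    by (auto dest!: compact_imp_bounded simp: bounded_iff)
  ultimately show ?thesis
    by (intro integrable_const_bound[where B=K] AE_I2) auto
qed

text \<open>The uniform distribution on the ball inherits the invariance of Lebesgue measure because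
  \<open>T\<close> preserves norms, and \<open>T\<close> commutes with the radial projection
  \<open>sgn\<close>.\<close>

lemma integral_sphere_measure_orthogonal_transformation:
  fixes f :: "'a::euclidean_space \<Rightarrow> real" and T :: "'a \<Rightarrow> 'a"
  assumes T: "orthogonal_transformation T" and f: "continuous_on (sphere 0 1) f"
  shows "(\<integral>x. f (T x) \<partial>sphere_measure) = (\<integral>x. f x \<partial>sphere_measure)"
proof -
  let ?S = "sphere 0 1 :: 'a set" and ?B = "ball 0 1 :: 'a set"
  let ?U = "uniform_measure lborel ?B"
  have lin: "linear T" and nT: "norm (T x) = norm x" for x
    using T by (auto simp: orthogonal_transformation)
  have contT: "continuous_on A T" for A
    using lin by (intro linear_continuous_on) (simp add: linear_conv_bounded_linear)
  then have [measurable]: "T \<in> borel_measurable borel"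
    by (rule borel_measurable_continuous_onI)
  have fT: "continuous_on ?S (\<lambda>x. f (T x))"
    by (intro continuous_on_compose2[OF f contT]) (auto simp: nT)
  \<comment> \<open>The restriction to the sphere becomes an indicator, which removes the centre of
    the ball, where \<open>sgn\<close> is \<open>0\<close>.\<close>
  have eq: "(\<integral>x. g x \<partial>sphere_measure) = (\<integral>y. indicator ?S (sgn y) *\<^sub>R g (sgn y) \<partial>?U)"
    if g: "continuous_on ?S g" for g :: "'a \<Rightarrow> real"
    unfolding sphere_measure_def using borel_measurable_continuous_on_indicator[OF _ g]
    by (subst integral_restrict_space) (auto simp: integral_distr)
  have U: "distr ?U borel T = ?U"
  proof (rule measure_eqI)
    fix A assume "A \<in> sets (distr ?U borel T)"
    then have A[measurable]: "A \<in> sets borel" by simp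
    have "emeasure (distr ?U borel T) A = emeasure lborel (?B \<inter> T -` A) / emeasure lborel ?B"
      using measurable_sets_borel[of T borel A] by (simp add: emeasure_distr)
    also have "?B \<inter> T -` A = T -` (?B \<inter> A) \<inter> space lborel" by (auto simp: nT)
    also have "emeasure lborel \<dots> = emeasure (distr lborel borel T) (?B \<inter> A)"
      by (rule emeasure_distr[symmetric]) auto
    finally show "emeasure (distr ?U borel T) A = emeasure ?U A"
      by (simp add: lborel_distr_orthogonal_transformation[OF T])
  qed simp
  have sT: "sgn (T y) = T (sgn y)" for y
    by (simp add: sgn_div_norm nT linear_cmul[OF lin])
  have [measurable]: "(\<lambda>x. indicator ?S x *\<^sub>R f x) \<in> borel_measurable borel"
    by (rule borel_measurable_continuous_on_indicator[OF _ f]) auto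
  have "(\<integral>x. f (T x) \<partial>sphere_measure) = (\<integral>y. indicator ?S (sgn (T y)) *\<^sub>R f (sgn (T y)) \<partial>?U)"
    unfolding eq[OF fT] by (intro Bochner_Integration.integral_cong) (auto simp: sT indicator_def nT)
  also have "\<dots> = (\<integral>y. indicator ?S (sgn y) *\<^sub>R f (sgn y) \<partial>distr ?U borel T)"
    by (rule integral_distr[symmetric]) measurable
  finally show ?thesis unfolding U eq[OF f] .
qed

text \<open>Joint continuity on the compact set \<open>T \<times> sphere 0 1\<close> makes
  \<open>G'\<close> uniformly continuous, so the difference quotients converge uniformly in
  \<open>x\<close>. Derivatives are taken within \<open>T\<close> so that the end point
  \<open>t = 0\<close> of the heat flow is covered.\<close>

lemma has_real_derivative_integral_sphere_measure:
  fixes G G' :: "real \<Rightarrow> 'a::euclidean_space \<Rightarrow> real"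
  assumes T: "compact T" "convex T" "t0 \<in> T"
    and der: "\<And>t x. t \<in> T \<Longrightarrow> x \<in> sphere 0 1 \<Longrightarrow> ((\<lambda>s. G s x) has_real_derivative G' t x) (at t within T)"
    and G: "\<And>t. t \<in> T \<Longrightarrow> continuous_on (sphere 0 1) (G t)"
    and G': "continuous_on (T \<times> sphere 0 1) (\<lambda>(t, x). G' t x)"
  shows "((\<lambda>t. \<integral>x. G t x \<partial>sphere_measure) has_real_derivative (\<integral>x. G' t0 x \<partial>sphere_measure)) (at t0 within T)"
  unfolding has_field_derivative_def has_derivative_within_alt
proof (intro conjI allI impI bounded_linear_mult_right)
  fix e :: real assume e: "e > 0"
  let ?S = "sphere 0 1 :: 'a set"
  interpret prob_space "sphere_measure :: 'a measure" by (rule prob_space_sphere_measure)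
  have G't: "continuous_on ?S (G' t)" if "t \<in> T" for t
    using continuous_on_compose2[OF G', of ?S "\<lambda>x. (t, x)"] that by (auto simp: continuous_on_Pair)
  have "uniformly_continuous_on (T \<times> ?S) (\<lambda>(t, x). G' t x)"
    using T by (intro compact_uniformly_continuous[OF G'] compact_Times) auto
  from uniformly_continuous_onE[OF this e] obtain \<delta> where \<delta>: "\<delta> > 0"
    and uc: "\<And>t x t' x'. t \<in> T \<Longrightarrow> t' \<in> T \<Longrightarrow> x \<in> ?S \<Longrightarrow> x' \<in> ?S \<Longrightarrow> dist (t', x') (t, x) < \<delta> \<Longrightarrow> dist (G' t' x') (G' t x) < e"
    by (metis (mono_tags, lifting) SigmaI case_prod_conv)
  show "\<exists>\<delta>>0. \<forall>t\<in>T. norm (t - t0) < \<delta> \<longrightarrow>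
    norm ((\<integral>x. G t x \<partial>sphere_measure) - (\<integral>x. G t0 x \<partial>sphere_measure) - (\<integral>x. G' t0 x \<partial>sphere_measure) * (t - t0)) \<le> e * norm (t - t0)"
  proof (intro exI[of _ \<delta>] conjI ballI impI \<delta>)
    fix t assume t: "t \<in> T" "norm (t - t0) < \<delta>"
    have pt: "norm (G t x - G t0 x - G' t0 x * (t - t0)) \<le> e * norm (t - t0)" if x: "x \<in> ?S" for x
    proof -
      have sub: "closed_segment t0 t \<subseteq> T" using T t by (simp add: closed_segment_subset)
      \<comment> \<open>The mean value inequality, applied after subtracting the linear part: the
        derivative \<open>G' s x - G' t0 x\<close> is at most \<open>e\<close> on the whole
        segment.\<close>
      have "norm ((G t x - G' t0 x * t) - (G t0 x - G' t0 x * t0)) \<le> e * norm (t - t0)"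
      proof (rule field_differentiable_bound[of "closed_segment t0 t" "\<lambda>s. G s x - G' t0 x * s" "\<lambda>s. G' s x - G' t0 x"])
        fix s assume s: "s \<in> closed_segment t0 t"
        then have sT: "s \<in> T" using sub by auto
        show "((\<lambda>s. G s x - G' t0 x * s) has_field_derivative G' s x - G' t0 x) (at s within closed_segment t0 t)"
          by (auto intro!: derivative_eq_intros DERIV_subset[OF der[OF sT x] sub])
        have "dist (s, x) (t0, x) < \<delta>"
          using s t(2) by (auto simp: dist_Pair_Pair dist_norm closed_segment_eq_real_ivl split: if_splits)
        from uc[OF T(3) sT x x this] show "norm (G' s x - G' t0 x) \<le> e"
          by (simp add: dist_norm)
      qed auto
      then show ?thesis by (simp add: algebra_simps)
    qed
    have i: "integrable sphere_measure (G t)" "integrable sphere_measure (G t0)" "integrable sphere_measure (\<lambda>x. G' t0 x * (t - t0))"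
      using t T by (auto intro!: integrable_sphere_measure G G't integrable_mult_left)
    have "(\<integral>x. G t x \<partial>sphere_measure) - (\<integral>x. G t0 x \<partial>sphere_measure) - (\<integral>x. G' t0 x \<partial>sphere_measure) * (t - t0)
      = (\<integral>x. G t x - G t0 x - G' t0 x * (t - t0) \<partial>sphere_measure)"
      using i by simp
    also have "norm \<dots> \<le> (\<integral>x. norm (G t x - G t0 x - G' t0 x * (t - t0)) \<partial>sphere_measure)"
      by (rule integral_norm_bound)
    also have "\<dots> \<le> (\<integral>x. e * norm (t - t0) \<partial>(sphere_measure :: 'a measure))"
      using pt i by (intro integral_mono integrable_norm Bochner_Integration.integrable_diff) auto
    finally show "norm ((\<integral>x. G t x \<partial>sphere_measure) - (\<integral>x. G t0 x \<partial>sphere_measure) - (\<integral>x. G' t0 x \<partial>sphere_measure) * (t - t0)) \<le> e * norm (t - t0)"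
      using prob_space by simp
  qed
qed

text \<open>This is the rotation by the angle \<open>s\<close> in the plane of \<open>e\<close> and
  \<open>b\<close>, written as the identity plus a correction inside that plane.\<close>

lemma orthogonal_transformation_plane_rotation:
  fixes e b :: "'a::euclidean_space"
  assumes "e \<in> Basis" "b \<in> Basis" "e \<noteq> b"
  shows "orthogonal_transformation (\<lambda>x. x + ((cos s - 1) * (x \<bullet> e) + sin s * (x \<bullet> b)) *\<^sub>R e
    + ((cos s - 1) * (x \<bullet> b) - sin s * (x \<bullet> e)) *\<^sub>R b)"
  unfolding orthogonal_transformation_def
proof (intro conjI allI)
  show "linear (\<lambda>x. x + ((cos s - 1) * (x \<bullet> e) + sin s * (x \<bullet> b)) *\<^sub>R e
    + ((cos s - 1) * (x \<bullet> b) - sin s * (x \<bullet> e)) *\<^sub>R b)"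
    by (rule linearI) (auto simp: algebra_simps inner_simps)
  fix v w :: 'a
  have o: "e \<bullet> b = 0" "b \<bullet> e = 0" "e \<bullet> e = 1" "b \<bullet> b = 1"
    using assms by (auto simp: inner_Basis)
  \<comment> \<open>Naming the coefficients turns the expanded inner product into a polynomial
    identity modulo \<open>sin^2 + cos^2 = 1\<close>.\<close>
  have ortho: "v \<bullet> w + p * (e \<bullet> w) + q * (b \<bullet> w) + (p' * (v \<bullet> e) + q' * (v \<bullet> b)) + (p * p' + q * q') = v \<bullet> w"
    if "p = (cos s - 1) * (v \<bullet> e) + sin s * (v \<bullet> b)" "q = (cos s - 1) * (v \<bullet> b) - sin s * (v \<bullet> e)"
      "p' = (cos s - 1) * (w \<bullet> e) + sin s * (w \<bullet> b)" "q' = (cos s - 1) * (w \<bullet> b) - sin s * (w \<bullet> e)" for p q p' q'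
    using sin_cos_squared_add[of s] that unfolding inner_commute[of e w] inner_commute[of b w] by algebra
  show "(v + ((cos s - 1) * (v \<bullet> e) + sin s * (v \<bullet> b)) *\<^sub>R e + ((cos s - 1) * (v \<bullet> b) - sin s * (v \<bullet> e)) *\<^sub>R b) \<bullet>
    (w + ((cos s - 1) * (w \<bullet> e) + sin s * (w \<bullet> b)) *\<^sub>R e + ((cos s - 1) * (w \<bullet> b) - sin s * (w \<bullet> e)) *\<^sub>R b) = v \<bullet> w"
    by (subst ortho[OF refl refl refl refl, symmetric])
       (simp only: inner_add_left inner_add_right inner_scaleR_left inner_scaleR_right o, simp add: algebra_simps)
qed

text \<open>The integral of \<open>?\<phi> (R s x)\<close> does not depend on \<open>s\<close>, so
  its derivative at \<open>s = 0\<close> vanishes; the integrand in the claim is the derivative of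
  \<open>?\<phi> (R s x)\<close> there.\<close>

lemma integral_sphere_rotation_derivative:
  fixes e b :: "'a::euclidean_space"
  assumes eb: "e \<in> Basis" "b \<in> Basis" "e \<noteq> b"
    and h: "\<And>z. z \<in> {-1..1} \<Longrightarrow> (h has_real_derivative h' z) (at z)"
    and h': "continuous_on {-1..1} h'"
  shows "(\<integral>x. (x \<bullet> b)\<^sup>2 * h' (x \<bullet> e) - (x \<bullet> e) * h (x \<bullet> e) \<partial>sphere_measure) = 0"
proof -
  define R where "R s x = x + ((cos s - 1) * (x \<bullet> e) + sin s * (x \<bullet> b)) *\<^sub>R e
    + ((cos s - 1) * (x \<bullet> b) - sin s * (x \<bullet> e)) *\<^sub>R b" for s and x :: 'a
  have R: "orthogonal_transformation (R s)" for s
    unfolding R_def[abs_def] by (rule orthogonal_transformation_plane_rotation[OF eb])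
  have o: "e \<bullet> b = 0" "b \<bullet> e = 0" "e \<bullet> e = 1" "b \<bullet> b = 1"
    using eb by (auto simp: inner_Basis)
  have Re: "R s x \<bullet> e = cos s * (x \<bullet> e) + sin s * (x \<bullet> b)" and Rb: "R s x \<bullet> b = cos s * (x \<bullet> b) - sin s * (x \<bullet> e)" for s x
    by (auto simp: R_def inner_simps o algebra_simps)
  have ran: "x \<bullet> e \<in> {-1..1}" if "norm x = 1" for x
    using Basis_le_norm[OF eb(1), of x] that by auto
  have nR: "norm (R s x) = norm x" for s x
    using R by (simp add: orthogonal_transformation)
  have ran': "cos s * (x \<bullet> e) + sin s * (x \<bullet> b) \<in> {-1..1}" if "norm x = 1" for s x
    using ran[of "R s x"] that by (simp add: nR Re)
  have hc: "continuous_on {-1..1} h"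
    by (rule DERIV_continuous_on) (rule has_field_derivative_at_within[OF h])
  let ?\<phi> = "\<lambda>x. (x \<bullet> b) * h (x \<bullet> e)"
  let ?G' = "\<lambda>s x. (- sin s * (x \<bullet> b) - cos s * (x \<bullet> e)) * h (cos s * (x \<bullet> e) + sin s * (x \<bullet> b))
      + (cos s * (x \<bullet> b) - sin s * (x \<bullet> e))\<^sup>2 * h' (cos s * (x \<bullet> e) + sin s * (x \<bullet> b))"
  have \<phi>c: "continuous_on (sphere 0 1) ?\<phi>"
    using ran by (intro continuous_intros continuous_on_compose2[OF hc]) auto
  have "((\<lambda>s. \<integral>x. ?\<phi> (R s x) \<partial>sphere_measure) has_real_derivative (\<integral>x. ?G' 0 x \<partial>sphere_measure))
      (at 0 within {-1..1})"
  proof (rule has_real_derivative_integral_sphere_measure)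
    fix s and x :: 'a assume x: "x \<in> sphere 0 1"
    have "((\<lambda>s. (cos s * (x \<bullet> b) - sin s * (x \<bullet> e)) * h (cos s * (x \<bullet> e) + sin s * (x \<bullet> b)))
      has_real_derivative ?G' s x) (at s)"
      using x ran'[of x s] by (auto intro!: derivative_eq_intros DERIV_chain2[OF h] simp: power2_eq_square algebra_simps)
    then show "((\<lambda>s. ?\<phi> (R s x)) has_real_derivative ?G' s x) (at s within {-1..1})"
      by (simp add: Re Rb has_field_derivative_at_within)
  next
    fix s
    show "continuous_on (sphere 0 1) (\<lambda>x. ?\<phi> (R s x))"
      unfolding Re Rb using ran' by (intro continuous_intros continuous_on_compose2[OF hc]) auto
  next
    show "continuous_on ({-1..1} \<times> sphere 0 1) (\<lambda>(s, x). ?G' s x)"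
      unfolding case_prod_beta using ran'
      by (intro continuous_intros continuous_on_compose2[OF hc] continuous_on_compose2[OF h']) auto
  qed auto
  moreover have "(\<lambda>s. \<integral>x. ?\<phi> (R s x) \<partial>sphere_measure) = (\<lambda>s. \<integral>x. ?\<phi> x \<partial>sphere_measure)"
    using integral_sphere_measure_orthogonal_transformation[OF R \<phi>c] by auto
  moreover have "at (0::real) within {-1..1} = at 0"
    by (rule at_within_interior) auto
  ultimately have "((\<lambda>s. \<integral>x. ?\<phi> x \<partial>sphere_measure) has_real_derivative (\<integral>x. ?G' 0 x \<partial>sphere_measure)) (at 0)"
    by simp
  from DERIV_unique[OF this DERIV_const] show ?thesis
    by (simp add: algebra_simps)
qed

text \<open>Rotating \<open>x \<mapsto> (x \<bullet> b) h (x \<bullet> e)\<close> in the plane of \<open>b\<close> and \<open>e\<close>, and summing over \<open>b\<close>.\<close>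

lemma sphere_integration_by_parts:
  fixes e :: "'a::euclidean_space"
  assumes e: "e \<in> Basis"
    and h: "\<And>z. z \<in> {-1..1} \<Longrightarrow> (h has_real_derivative h' z) (at z)"
    and h': "continuous_on {-1..1} h'"
  shows "(\<integral>x. (1 - (x \<bullet> e)\<^sup>2) * h' (x \<bullet> e) - (real DIM('a) - 1) * (x \<bullet> e) * h (x \<bullet> e) \<partial>sphere_measure) = 0"
proof -
  have ran: "x \<bullet> e \<in> {-1..1}" if "norm x = 1" for x
    using Basis_le_norm[OF e, of x] that by auto
  have hc: "continuous_on {-1..1} h"
    by (rule DERIV_continuous_on) (rule has_field_derivative_at_within[OF h])
  have "(\<integral>x. (1 - (x \<bullet> e)\<^sup>2) * h' (x \<bullet> e) - (real DIM('a) - 1) * (x \<bullet> e) * h (x \<bullet> e) \<partial>sphere_measure)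
    = (\<integral>x. (\<Sum>b\<in>Basis - {e}. (x \<bullet> b)\<^sup>2 * h' (x \<bullet> e) - (x \<bullet> e) * h (x \<bullet> e)) \<partial>sphere_measure)"
  proof (rule Bochner_Integration.integral_cong[OF refl])
    fix x :: 'a assume "x \<in> space sphere_measure"
    then have "x \<bullet> x = 1" by (simp add: dot_square_norm)
    then have "(\<Sum>b\<in>Basis. (x \<bullet> b)\<^sup>2) = 1"
      by (subst (asm) euclidean_inner) (simp add: power2_eq_square)
    then have "(\<Sum>b\<in>Basis - {e}. (x \<bullet> b)\<^sup>2) = 1 - (x \<bullet> e)\<^sup>2"
      using e by (simp add: sum_diff1)
    moreover have "real (card (Basis - {e})) = real DIM('a) - 1"
      using e by (simp add: of_nat_diff Suc_leI)
    ultimately show "(1 - (x \<bullet> e)\<^sup>2) * h' (x \<bullet> e) - (real DIM('a) - 1) * (x \<bullet> e) * h (x \<bullet> e)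
      = (\<Sum>b\<in>Basis - {e}. (x \<bullet> b)\<^sup>2 * h' (x \<bullet> e) - (x \<bullet> e) * h (x \<bullet> e))"
      by (simp add: sum_subtractf flip: sum_distrib_right)
  qed
  also have "\<dots> = (\<Sum>b\<in>Basis - {e}. \<integral>x. (x \<bullet> b)\<^sup>2 * h' (x \<bullet> e) - (x \<bullet> e) * h (x \<bullet> e) \<partial>sphere_measure)"
    using ran by (intro Bochner_Integration.integral_sum integrable_sphere_measure continuous_intros
      continuous_on_compose2[OF hc] continuous_on_compose2[OF h']) auto
  also have "\<dots> = 0"
    using e by (intro sum.neutral ballI integral_sphere_rotation_derivative h h') auto
  finally show ?thesis .
qed

section \<open>Calculus on the sphere\<close>

text \<open>Both sides choose from the same set of derivatives, so they agree even at points where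
  this set is empty.\<close>

lemma frechet_derivative_cong_open:
  assumes "open U" "x \<in> U" "\<And>y. y \<in> U \<Longrightarrow> f y = g y"
  shows "frechet_derivative f (at x) = frechet_derivative g (at x)"
proof -
  have "(f has_derivative D) (at x) \<longleftrightarrow> (g has_derivative D) (at x)" for D
    using has_derivative_transform_within_open[OF _ assms(1,2)] assms(3) by metis
  then show ?thesis by (simp add: frechet_derivative_def)
qed

lemma C_on_cong:
  assumes "open U" "\<And>y. y \<in> U \<Longrightarrow> f y = g y" "C_on k U f"
  shows "C_on k U g"
  using assms(2,3)
proof (induction k arbitrary: f g)
  case 0
  then show ?case by (auto cong: continuous_on_cong)
next
  case (Suc k)
  have "g differentiable at x" if "x \<in> U" for x
  proof -
    have "f differentiable at x" using Suc.prems(2) that by simp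
    then show ?thesis
      using has_derivative_transform_within_open[of f _ x UNIV U g] assms(1) that Suc.prems(1)
      unfolding differentiable_def by blast
  qed
  moreover have "C_on k U (\<lambda>x. frechet_derivative g (at x) b)" if "b \<in> Basis" for b
  proof (rule Suc.IH)
    show "C_on k U (\<lambda>x. frechet_derivative f (at x) b)"
      using Suc.prems(2) that by simp
    show "frechet_derivative f (at x) b = frechet_derivative g (at x) b" if "x \<in> U" for x
      using frechet_derivative_cong_open[OF assms(1) that Suc.prems(1)] by simp
  qed
  ultimately show ?case by simp
qed

text \<open>Meant for the product rule, where one factor stays undifferentiated and has to be
  lowered by one order.\<close>

lemma C_on_Suc_D: "C_on (Suc k) U f \<Longrightarrow> C_on k U f"
proof (induction k arbitrary: f)
  case 0
  then show ?case
    by (auto intro!: continuous_at_imp_continuous_on differentiable_imp_continuous_within)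
next
  case (Suc k)
  then show ?case by (metis C_on.simps(2))
qed

lemma C_on_const: "C_on k U (\<lambda>_. c)"
  by (induction k arbitrary: c) auto

lemma C_on_add:
  assumes "open U" "C_on k U f" "C_on k U g"
  shows "C_on k U (\<lambda>x. f x + g x)"
  using assms(2,3)
proof (induction k arbitrary: f g)
  case 0
  then show ?case by (auto intro: continuous_intros)
next
  case (Suc k)
  have "((\<lambda>x. f x + g x) has_derivative
      (\<lambda>h. frechet_derivative f (at x) h + frechet_derivative g (at x) h)) (at x)" if "x \<in> U" for x
    using Suc.prems that by (intro has_derivative_add) (auto simp: frechet_derivative_works)
  note D = frechet_derivative_at[OF this]
  have "C_on k U (\<lambda>x. frechet_derivative (\<lambda>x. f x + g x) (at x) b)" if b: "b \<in> Basis" for b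
  proof (rule C_on_cong[OF assms(1)])
    show "C_on k U (\<lambda>x. frechet_derivative f (at x) b + frechet_derivative g (at x) b)"
      using Suc.prems b by (intro Suc.IH) auto
    show "frechet_derivative f (at x) b + frechet_derivative g (at x) b
        = frechet_derivative (\<lambda>x. f x + g x) (at x) b" if "x \<in> U" for x
      using fun_cong[OF D[OF that], of b] by simp
  qed
  then show ?case using Suc.prems by auto
qed

lemma C_on_mult:
  assumes "open U" "C_on k U f" "C_on k U g"
  shows "C_on k U (\<lambda>x. f x * g x)"
  using assms(2,3)
proof (induction k arbitrary: f g)
  case 0
  then show ?case by (auto intro: continuous_intros)
next
  case (Suc k)
  have "((\<lambda>x. f x * g x) has_derivative
      (\<lambda>h. f x * frechet_derivative g (at x) h + frechet_derivative f (at x) h * g x)) (at x)" if "x \<in> U" for x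
    using Suc.prems that by (intro has_derivative_mult) (auto simp: frechet_derivative_works)
  note D = frechet_derivative_at[OF this]
  have "C_on k U (\<lambda>x. frechet_derivative (\<lambda>x. f x * g x) (at x) b)" if b: "b \<in> Basis" for b
  proof (rule C_on_cong[OF assms(1)])
    show "C_on k U (\<lambda>x. f x * frechet_derivative g (at x) b + frechet_derivative f (at x) b * g x)"
      using Suc.prems b by (intro C_on_add[OF assms(1)] Suc.IH) (simp_all add: C_on_Suc_D del: C_on.simps, simp_all)
    show "f x * frechet_derivative g (at x) b + frechet_derivative f (at x) b * g x
        = frechet_derivative (\<lambda>x. f x * g x) (at x) b" if "x \<in> U" for x
      using fun_cong[OF D[OF that], of b] by simp
  qed
  then show ?case using Suc.prems by auto
qed

lemma C_on_inner: "C_on k U (\<lambda>x. x \<bullet> e)"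
proof (cases k)
  case (Suc j)
  have "((\<lambda>x. x \<bullet> e) has_derivative (\<lambda>h. h \<bullet> e)) (at x)" for x
    by (auto intro!: derivative_eq_intros)
  from frechet_derivative_at[OF this, symmetric] Suc show ?thesis
    by (auto simp: C_on_const)
qed (auto intro: continuous_intros)

text \<open>The partial derivatives are \<open>- (x \<bullet> b) / norm x ^ 3\<close>, a polynomial
  in the coordinates and in the function itself, so the induction on \<open>k\<close>
  closes.\<close>

lemma C_on_inverse_norm: "C_on k (- {0}) (\<lambda>x::'a::euclidean_space. inverse (norm x))"
proof (induction k)
  case 0
  show ?case by (auto intro!: continuous_intros)
next
  case (Suc k)
  let ?i = "\<lambda>x::'a. inverse (norm x)"
  have D: "(?i has_derivative (\<lambda>h. - 1 * ((x \<bullet> h) * (?i x * (?i x * ?i x))))) (at x)" if "x \<noteq> 0" for x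
    using that by (auto intro!: derivative_eq_intros has_derivative_norm simp: sgn_div_norm inner_commute field_simps)
  have "C_on k (- {0}) (\<lambda>x. frechet_derivative ?i (at x) b)" if "b \<in> Basis" for b
  proof (rule C_on_cong)
    show "C_on k (- {0}) (\<lambda>x. - 1 * ((x \<bullet> b) * (?i x * (?i x * ?i x))))"
      by (intro C_on_mult C_on_const C_on_inner Suc.IH) auto
    show "- 1 * ((x \<bullet> b) * (?i x * (?i x * ?i x))) = frechet_derivative ?i (at x) b" if "x \<in> - {0}" for x
      using fun_cong[OF frechet_derivative_at[OF D[of x]], of b] that by simp
  qed auto
  then show ?case using D by (auto simp: differentiable_def)
qed

lemma smooth_sphere_quadratic: "smooth_sphere (\<lambda>x. a0 + a1 * (x \<bullet> e) + a2 * (x \<bullet> e)\<^sup>2)"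
  unfolding smooth_sphere_def C_sphere_def
proof
  fix k
  let ?z = "\<lambda>y. (y \<bullet> e) * inverse (norm y)"
  have z: "C_on k (- {0}) ?z"
    by (intro C_on_mult C_on_inner C_on_inverse_norm) auto
  have "C_on k (- {0}) (\<lambda>y. (a0 + a1 * ?z y) + a2 * (?z y * ?z y))"
    by (intro C_on_add C_on_mult C_on_const z) auto
  then show "C_on k (- {0}) (\<lambda>y. a0 + a1 * (sgn y \<bullet> e) + a2 * (sgn y \<bullet> e)\<^sup>2)"
    by (simp add: sgn_div_norm power2_eq_square mult_ac)
qed

section \<open>Gradient and Laplacian of zonal functions\<close>

lemma sphere_grad_cong:
  assumes "norm x = 1" "\<And>x. x \<in> sphere 0 1 \<Longrightarrow> f x = g x"
  shows "sphere_grad f x = sphere_grad g x"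
  unfolding sphere_grad_def using assms
  by (subst frechet_derivative_cong_open[of "- {0}" _ _ "\<lambda>y. g (sgn y)"]) (auto simp: norm_sgn)

lemma has_derivative_sgn_sphere:
  fixes x :: "'a::euclidean_space"
  assumes "norm x = 1"
  shows "(sgn has_derivative (\<lambda>h. h - (h \<bullet> x) *\<^sub>R x)) (at x)"
proof -
  have "x \<noteq> 0" using assms by auto
  then show ?thesis unfolding sgn_div_norm[abs_def] using assms
    by (auto intro!: derivative_eq_intros has_derivative_norm simp: sgn_div_norm)
qed

text \<open>The derivative of \<open>sgn\<close> is the orthogonal projection onto the tangent
  space; being self-adjoint, it can be moved from \<open>h\<close> to \<open>e\<close>.\<close>

lemma has_derivative_zonal_sphere:
  fixes x e :: "'a::euclidean_space"
  assumes "norm x = 1" "(g has_real_derivative g') (at (x \<bullet> e))"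
  shows "((\<lambda>y. g (sgn y \<bullet> e)) has_derivative (\<lambda>h. g' * (h \<bullet> (e - (x \<bullet> e) *\<^sub>R x)))) (at x)"
proof -
  have x: "sgn x = x" using assms by (simp add: sgn_div_norm)
  have "((\<lambda>y. g (sgn y \<bullet> e)) has_derivative (\<lambda>h. g' * ((h - (h \<bullet> x) *\<^sub>R x) \<bullet> e))) (at x)"
    by (rule has_derivative_compose[of "\<lambda>y. sgn y \<bullet> e" _ _ _ g])
       (use assms x in \<open>auto intro!: has_derivative_inner_left has_derivative_sgn_sphere simp: has_field_derivative_def\<close>)
  then show ?thesis by (simp add: inner_simps algebra_simps)
qed

lemma sphere_grad_zonal:
  fixes x e :: "'a::euclidean_space"
  assumes "norm x = 1" "(g has_real_derivative g') (at (x \<bullet> e))"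
  shows "sphere_grad (\<lambda>y. g (y \<bullet> e)) x = g' *\<^sub>R (e - (x \<bullet> e) *\<^sub>R x)"
  unfolding sphere_grad_def frechet_derivative_at[OF has_derivative_zonal_sphere[OF assms], symmetric]
  by (subst (3) euclidean_representation[symmetric]) (simp add: scaleR_sum_right inner_commute)

lemma norm_sphere_grad_zonal:
  fixes x e :: "'a::euclidean_space"
  assumes "norm x = 1" "norm e = 1" "(g has_real_derivative g') (at (x \<bullet> e))"
  shows "(norm (sphere_grad (\<lambda>y. g (y \<bullet> e)) x))\<^sup>2 = g'\<^sup>2 * (1 - (x \<bullet> e)\<^sup>2)"
proof -
  have "x \<bullet> x = 1" "e \<bullet> e = 1" using assms by (simp_all add: dot_square_norm)
  then have "(norm (e - (x \<bullet> e) *\<^sub>R x))\<^sup>2 = 1 - (x \<bullet> e)\<^sup>2"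
    unfolding power2_norm_eq_inner by (simp add: inner_simps power2_eq_square inner_commute)
  then show ?thesis
    by (simp add: sphere_grad_zonal[OF assms(1,3)] power_mult_distrib)
qed

text \<open>The gradient field is \<open>g1 z\<close> times the tangential part \<open>u\<close> of
  \<open>e\<close>. In the trace of its derivative, \<open>norm u ^ 2 = 1 - z^2\<close> gives the
  second-order term, and the trace \<open>DIM('a) - 1\<close> of the tangential projection gives the
  first-order one.\<close>

lemma laplace_beltrami_zonal:
  fixes x e :: "'a::euclidean_space"
  assumes x: "norm x = 1" and e: "norm e = 1"
    and g: "\<And>z. z \<in> {-1..1} \<Longrightarrow> (g has_real_derivative g1 z) (at z)"
    and g1: "(g1 has_real_derivative g2) (at (x \<bullet> e))"
  shows "laplace_beltrami (\<lambda>y. g (y \<bullet> e)) x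
    = (1 - (x \<bullet> e)\<^sup>2) * g2 - (real DIM('a) - 1) * (x \<bullet> e) * g1 (x \<bullet> e)"
proof -
  define z where "z = x \<bullet> e"
  define u where "u = e - z *\<^sub>R x"
  have xx: "x \<bullet> x = 1" "e \<bullet> e = 1" "sgn x = x" using x e by (simp_all add: dot_square_norm sgn_div_norm)
  have ran: "y \<bullet> e \<in> {-1..1}" if "norm y = 1" for y
    using Cauchy_Schwarz_ineq2[of y e] that e by (auto simp: abs_le_iff)
  have perp: "(h - (h \<bullet> x) *\<^sub>R x) \<bullet> e = h \<bullet> (e - (x \<bullet> e) *\<^sub>R x)" for h
    by (simp add: inner_simps)
  have "((\<lambda>y. g1 (sgn y \<bullet> e) *\<^sub>R (e - (sgn y \<bullet> e) *\<^sub>R sgn y)) has_derivative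
    (\<lambda>h. g1 z *\<^sub>R (- (z *\<^sub>R (h - (h \<bullet> x) *\<^sub>R x) + (h \<bullet> u) *\<^sub>R x)) + (g2 * (h \<bullet> u)) *\<^sub>R u)) (at x)"
    using has_derivative_zonal_sphere[OF x g1]
    by (auto intro!: derivative_eq_intros has_derivative_sgn_sphere x simp: xx z_def u_def perp)
  moreover have "sphere_grad (\<lambda>y. g (y \<bullet> e)) (sgn y) = g1 (sgn y \<bullet> e) *\<^sub>R (e - (sgn y \<bullet> e) *\<^sub>R sgn y)" if "y \<in> - {0}" for y
    using that by (intro sphere_grad_zonal g ran) (auto simp: norm_sgn)
  moreover have "x \<in> - {0}" using x by auto
  ultimately have "((\<lambda>y. sphere_grad (\<lambda>y. g (y \<bullet> e)) (sgn y)) has_derivative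
    (\<lambda>h. g1 z *\<^sub>R (- (z *\<^sub>R (h - (h \<bullet> x) *\<^sub>R x) + (h \<bullet> u) *\<^sub>R x)) + (g2 * (h \<bullet> u)) *\<^sub>R u)) (at x)"
    by (elim has_derivative_transform_within_open[where s = "- {0}"]) auto
  note D = frechet_derivative_at[OF this, symmetric]
  \<comment> \<open>Each summand is one diagonal entry of the derivative \<open>D\<close>; the sums
    over the basis then become inner products of \<open>u\<close> and \<open>x\<close>.\<close>
  have "laplace_beltrami (\<lambda>y. g (y \<bullet> e)) x
    = (\<Sum>b\<in>Basis. g2 * ((u \<bullet> b) * (u \<bullet> b)) - g1 z * (u \<bullet> b) * (x \<bullet> b) - g1 z * z * 1
         + g1 z * z * ((x \<bullet> b) * (x \<bullet> b)))"
    unfolding laplace_beltrami_def sphere_div_def D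
    by (intro sum.cong refl) (simp add: inner_simps inner_commute algebra_simps)
  also have "\<dots> = g2 * (u \<bullet> u) - g1 z * (u \<bullet> x) - g1 z * z * real DIM('a) + g1 z * z * (x \<bullet> x)"
    by (simp only: euclidean_inner[of u u] euclidean_inner[of u x] euclidean_inner[of x x] sum.distrib sum_subtractf
        sum_distrib_left mult.assoc) simp
  also have "\<dots> = (1 - z\<^sup>2) * g2 - (real DIM('a) - 1) * z * g1 z"
    by (simp add: u_def inner_simps xx z_def inner_commute power2_eq_square algebra_simps)
  finally show ?thesis by (simp add: z_def)
qed

text \<open>The extension is constant along rays, so its derivative is homogeneous of degree
  \<open>-1\<close>; this is the chain rule for the scaling that maps \<open>y\<close> to
  \<open>sgn y\<close>.\<close>

lemma frechet_derivative_sgn_scale: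
  fixes f :: "'a::euclidean_space \<Rightarrow> real"
  assumes "\<And>y. y \<noteq> 0 \<Longrightarrow> (\<lambda>y. f (sgn y)) differentiable at y" "y \<noteq> 0"
  shows "frechet_derivative (\<lambda>y. f (sgn y)) (at (sgn y)) h = norm y * frechet_derivative (\<lambda>y. f (sgn y)) (at y) h"
proof -
  let ?F = "\<lambda>y. f (sgn y)" and ?r = "inverse (norm y)"
  have r: "?r > 0" "sgn y = ?r *\<^sub>R y" using assms(2) by (auto simp: sgn_div_norm)
  have "(?F has_derivative frechet_derivative ?F (at (sgn y))) (at (?r *\<^sub>R y))"
    using assms(1)[of "sgn y"] assms(2) r(2) by (simp add: frechet_derivative_works sgn_zero_iff)
  from has_derivative_compose[OF has_derivative_scaleR_right[OF has_derivative_ident, of ?r] this]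
  have "((\<lambda>w. f (sgn (?r *\<^sub>R w))) has_derivative (\<lambda>h. frechet_derivative ?F (at (sgn y)) (?r *\<^sub>R h))) (at y)" .
  moreover have "sgn (?r *\<^sub>R w) = sgn w" for w :: 'a
    using r(1) by (simp add: sgn_scaleR)
  ultimately have "(?F has_derivative (\<lambda>h. frechet_derivative ?F (at (sgn y)) (?r *\<^sub>R h))) (at y)" by simp
  from frechet_derivative_at[OF this]
  have "frechet_derivative ?F (at y) h = frechet_derivative ?F (at (sgn y)) (?r *\<^sub>R h)" by metis
  also have "\<dots> = ?r * frechet_derivative ?F (at (sgn y)) h"
    using linear_cmul[OF linear_frechet_derivative[OF assms(1)[of "sgn y"]]] assms(2) by (simp add: sgn_zero_iff)
  finally show ?thesis using assms(2) by simp
qed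

text \<open>
  Off the origin \<open>sphere_grad f \<circ> sgn\<close> is \<open>norm y\<close> times the Euclidean gradient of the homogeneous
  extension; the first summand comes from differentiating the factor \<open>norm y\<close>.
\<close>

lemma laplace_beltrami_eq_sum:
  fixes f :: "'a::euclidean_space \<Rightarrow> real"
  defines "D \<equiv> \<lambda>b y. frechet_derivative (\<lambda>y. f (sgn y)) (at y) b"
  assumes f: "C_sphere 2 f" and x: "norm x = 1"
  shows "laplace_beltrami f x = (\<Sum>b\<in>Basis. (x \<bullet> b) * D b x + frechet_derivative (D b) (at x) b)"
proof -
  have dF: "(\<lambda>y. f (sgn y)) differentiable at y" if "y \<noteq> 0" for y
    using f that by (auto simp: C_sphere_def numeral_2_eq_2)
  have dD: "D b differentiable at y" if "y \<noteq> 0" "b \<in> Basis" for y b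
    using f that by (auto simp: C_sphere_def numeral_2_eq_2 D_def)
  have x0: "x \<noteq> 0" and sx: "sgn x = x" using x by (auto simp: sgn_div_norm)
  have sg: "sphere_grad f (sgn y) = (\<Sum>b\<in>Basis. (norm y * D b y) *\<^sub>R b)" if "y \<in> - {0}" for y
    using frechet_derivative_sgn_scale[OF dF] that by (simp add: sphere_grad_def D_def)
  have "((\<lambda>y. \<Sum>b\<in>Basis. (norm y * D b y) *\<^sub>R b) has_derivative
      (\<lambda>h. \<Sum>b\<in>Basis. (norm x * frechet_derivative (D b) (at x) h + (h \<bullet> sgn x) * D b x) *\<^sub>R b)) (at x)"
    using dD[OF x0] x0 unfolding frechet_derivative_works
    by (intro has_derivative_sum has_derivative_scaleR_left has_derivative_mult has_derivative_norm)
  then have "((\<lambda>y. sphere_grad f (sgn y)) has_derivative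
      (\<lambda>h. \<Sum>b\<in>Basis. (norm x * frechet_derivative (D b) (at x) h + (h \<bullet> sgn x) * D b x) *\<^sub>R b)) (at x)"
    by (rule has_derivative_transform_within_open[where s = "- {0}"]) (use x0 sg in auto)
  note Dg = frechet_derivative_at[OF this, symmetric]
  show ?thesis
    unfolding laplace_beltrami_def sphere_div_def Dg
    by (intro sum.cong refl) (simp add: x sx inner_commute[of x] add.commute)
qed

section \<open>Uniqueness for the heat equation\<close>

text \<open>\<open>frechet_derivative\<close> is additive where derivatives exist, so the two orders
  of differentiability in \<open>C_sphere 2\<close> are used on the coordinate form
  \<open>laplace_beltrami_eq_sum\<close>.\<close>

lemma laplace_beltrami_diff:
  fixes f g :: "'a::euclidean_space \<Rightarrow> real"
  assumes f: "C_sphere 2 f" and g: "C_sphere 2 g" and x: "norm x = 1"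
  shows "C_sphere 2 (\<lambda>y. f y - g y)"
    and "laplace_beltrami (\<lambda>y. f y - g y) x = laplace_beltrami f x - laplace_beltrami g x"
proof -
  have "C_on 2 (- {0}) (\<lambda>y. f (sgn y) + - 1 * g (sgn y))"
    using f g unfolding C_sphere_def by (intro C_on_add C_on_mult C_on_const) auto
  then show fg: "C_sphere 2 (\<lambda>y. f y - g y)"
    by (simp add: C_sphere_def)
  define F where "F y = f (sgn y)" for y
  define G where "G y = g (sgn y)" for y
  have dF: "F differentiable at y" "G differentiable at y" if "y \<noteq> 0" for y
    using f g that by (auto simp: C_sphere_def numeral_2_eq_2 F_def[abs_def] G_def[abs_def])
  have dD: "(\<lambda>y. frechet_derivative F (at y) b) differentiable at y" "(\<lambda>y. frechet_derivative G (at y) b) differentiable at y"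
    if "y \<noteq> 0" "b \<in> Basis" for y b
    using f g that by (auto simp: C_sphere_def numeral_2_eq_2 F_def[abs_def] G_def[abs_def])
  have x0: "x \<noteq> 0" using x by auto
  have D: "frechet_derivative (\<lambda>y. F y - G y) (at y) b = frechet_derivative F (at y) b - frechet_derivative G (at y) b"
    if "y \<noteq> 0" for y b
    using fun_cong[OF frechet_derivative_at[OF has_derivative_diff[OF dF[OF that, unfolded frechet_derivative_works]]], of b]
    by simp
  have DD: "frechet_derivative (\<lambda>y. frechet_derivative (\<lambda>y. F y - G y) (at y) b) (at x) b =
     frechet_derivative (\<lambda>y. frechet_derivative F (at y) b) (at x) b - frechet_derivative (\<lambda>y. frechet_derivative G (at y) b) (at x) b"
    if b: "b \<in> Basis" for b
  proof -
    have "frechet_derivative (\<lambda>y. frechet_derivative (\<lambda>y. F y - G y) (at y) b) (at x) =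
      frechet_derivative (\<lambda>y. frechet_derivative F (at y) b - frechet_derivative G (at y) b) (at x)"
      by (rule frechet_derivative_cong_open[of "- {0}"]) (use x0 D in auto)
    with fun_cong[OF frechet_derivative_at[OF has_derivative_diff[OF dD[OF x0 b, unfolded frechet_derivative_works]]], of b]
    show ?thesis by simp
  qed
  show "laplace_beltrami (\<lambda>y. f y - g y) x = laplace_beltrami f x - laplace_beltrami g x"
    unfolding laplace_beltrami_eq_sum[OF f x] laplace_beltrami_eq_sum[OF g x] laplace_beltrami_eq_sum[OF fg x]
    unfolding F_def[symmetric] G_def[symmetric]
    by (simp add: D[OF x0] DD sum_subtractf[symmetric] algebra_simps)
qed

text \<open>A maximum over the sphere is a maximum of the homogeneous extension over the punctured
  space. There the gradient vanishes, which removes the first-order term of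
  \<open>laplace_beltrami_eq_sum\<close>, and no pure second derivative is positive.\<close>

lemma laplace_beltrami_nonpos_at_max:
  fixes f :: "'a::euclidean_space \<Rightarrow> real"
  assumes f: "C_sphere 2 f" and x: "norm x = 1" and max: "\<And>y. y \<in> sphere 0 1 \<Longrightarrow> f y \<le> f x"
  shows "laplace_beltrami f x \<le> 0"
proof -
  define F where "F y = f (sgn y)" for y
  define D where "D b y = frechet_derivative F (at y) b" for b y
  have dF: "(F has_derivative (\<lambda>h. D h y)) (at y)" if "y \<noteq> 0" for y
    using f that by (auto simp: C_sphere_def numeral_2_eq_2 F_def[abs_def] D_def frechet_derivative_works)
  have dD: "(D b has_derivative frechet_derivative (D b) (at y)) (at y)" if "y \<noteq> 0" "b \<in> Basis" for y b
    using f that by (auto simp: C_sphere_def numeral_2_eq_2 F_def[abs_def] D_def[abs_def] simp flip: frechet_derivative_works)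
  have x0: "x \<noteq> 0" and sx: "sgn x = x" using x by (auto simp: sgn_div_norm)
  have Fle: "F y \<le> F x" if "y \<noteq> 0" for y
    using max[of "sgn y"] that by (simp add: F_def sx norm_sgn)
  have "(\<lambda>h. D h x) = (\<lambda>h. 0)"
    by (rule has_derivative_local_max[OF dF[OF x0]])
       (use eventually_at_in_open[OF open_Compl[OF closed_singleton[of 0]], of x] x0 in \<open>auto elim!: eventually_mono intro: Fle\<close>)
  then have D0: "D b x = 0" for b by metis
  have "frechet_derivative (D b) (at x) b \<le> 0" if b: "b \<in> Basis" for b
  proof (rule ccontr)
    assume "\<not> frechet_derivative (D b) (at x) b \<le> 0"
    then have pos: "frechet_derivative (D b) (at x) b > 0" by simp
    \<comment> \<open>The bound \<open>1\<close> keeps the segment away from the origin. On it, a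
      positive second derivative would make \<open>D b\<close> positive just after
      \<open>s = 0\<close>, and \<open>F\<close> would rise above its maximum.\<close>
    have ne: "x + s *\<^sub>R b \<noteq> 0" if "\<bar>s\<bar> < 1" for s
    proof
      assume "x + s *\<^sub>R b = 0"
      then have "norm x = norm (s *\<^sub>R b)" by (metis add_eq_0_iff norm_minus_cancel)
      then show False using x b that by simp
    qed
    have line: "((\<lambda>s. x + s *\<^sub>R b) has_derivative (\<lambda>h. h *\<^sub>R b)) (at s)" for s
      by (auto intro!: derivative_eq_intros)
    have "((\<lambda>s. D b (x + s *\<^sub>R b)) has_derivative (\<lambda>h. frechet_derivative (D b) (at x) (h *\<^sub>R b))) (at 0)"
      using has_derivative_compose[OF line[of 0], of "D b"] dD[OF x0 b] by simp
    then have d2: "((\<lambda>s. D b (x + s *\<^sub>R b)) has_real_derivative frechet_derivative (D b) (at x) b) (at 0)"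
      using linear_cmul[OF has_derivative_linear[OF dD[OF x0 b]]]
      by (simp add: has_field_derivative_def mult_commute_abs)
    have d1: "((\<lambda>s. F (x + s *\<^sub>R b)) has_real_derivative D b (x + s *\<^sub>R b)) (at s)" if "\<bar>s\<bar> < 1" for s
      using has_derivative_compose[OF line[of s] dF[OF ne[OF that]]]
        linear_cmul[OF has_derivative_linear[OF dF[OF ne[OF that]]]]
      by (simp add: has_field_derivative_def mult_commute_abs)
    from DERIV_pos_inc_right[OF d2 pos] obtain d where d: "d > 0" "\<And>h. 0 < h \<Longrightarrow> h < d \<Longrightarrow> D b (x + h *\<^sub>R b) > 0"
      by (auto simp: D0)
    define s where "s = min d 1 / 2"
    have s: "0 < s" "s < d" "s < 1" using d(1) by (auto simp: s_def)
    have "F (x + 0 *\<^sub>R b) < F (x + s *\<^sub>R b)"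
    proof (rule DERIV_pos_imp_increasing_open[OF s(1)])
      show "\<exists>l. ((\<lambda>s. F (x + s *\<^sub>R b)) has_real_derivative l) (at r) \<and> 0 < l" if "0 < r" "r < s" for r
        using that s by (intro exI[of _ "D b (x + r *\<^sub>R b)"] conjI d1 d) auto
      show "continuous_on {0..s} (\<lambda>s. F (x + s *\<^sub>R b))"
        using s by (intro DERIV_continuous_on[OF has_field_derivative_at_within[OF d1]]) auto
    qed
    then show False using Fle[OF ne[of s]] s by simp
  qed
  then have "(\<Sum>b\<in>Basis. (x \<bullet> b) * D b x + frechet_derivative (D b) (at x) b) \<le> 0"
    by (intro sum_nonpos) (simp add: D0)
  then show ?thesis
    unfolding laplace_beltrami_eq_sum[OF f x] D_def F_def .
qed

text \<open>Parabolic maximum principle: the penalty \<open>\<delta> * s\<close> forces the maximum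
  of \<open>w\<close> over the compact cylinder to lie at time \<open>0\<close>, where
  \<open>w\<close> vanishes.\<close>

lemma heat_solution_le:
  fixes \<rho>0 :: "'a::euclidean_space \<Rightarrow> real"
  assumes \<rho>: "heat_solution \<rho>0 \<rho>" and \<sigma>: "heat_solution \<rho>0 \<sigma>" and t: "t \<ge> 0" and x: "x \<in> sphere 0 1"
  shows "\<rho> t x \<le> \<sigma> t x"
proof (rule field_le_epsilon)
  fix e :: real assume e: "e > 0"
  \<comment> \<open>The denominator \<open>t + 1\<close> is positive also for \<open>t = 0\<close>
    and still gives \<open>\<delta> * t \<le> e\<close>.\<close>
  define \<delta> where "\<delta> = e / (t + 1)"
  have \<delta>: "\<delta> > 0" "\<delta> * t \<le> e" using e t by (auto simp: \<delta>_def field_simps)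
  define w where "w s y = \<rho> s y - \<sigma> s y - \<delta> * s" for s y
  have "continuous_on ({0..t} \<times> sphere 0 1) (\<lambda>(s, y). \<rho> s y)" "continuous_on ({0..t} \<times> sphere 0 1) (\<lambda>(s, y). \<sigma> s y)"
    using \<rho> \<sigma> by (auto simp: heat_solution_def elim!: continuous_on_subset)
  then have "continuous_on ({0..t} \<times> sphere 0 1) (\<lambda>p. w (fst p) (snd p))"
    unfolding w_def case_prod_beta by (intro continuous_intros)
  moreover have "compact ({0..t} \<times> sphere (0::'a) 1)" "(t, x) \<in> {0..t} \<times> sphere 0 1"
    using t x by (auto intro: compact_Times)
  ultimately obtain s y where s: "0 \<le> s" "s \<le> t" and y: "norm y = 1"
    and wmax: "\<And>r v. 0 \<le> r \<Longrightarrow> r \<le> t \<Longrightarrow> norm v = 1 \<Longrightarrow> w r v \<le> w s y"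
    using continuous_attains_sup[of "{0..t} \<times> sphere (0::'a) 1" "\<lambda>p. w (fst p) (snd p)"] by force
  have "s = 0"
  proof (rule ccontr)
    assume "s \<noteq> 0"
    then have s0: "s > 0" using s by simp
    have C: "C_sphere 2 (\<rho> s)" "C_sphere 2 (\<sigma> s)"
      and der: "((\<lambda>s. \<rho> s y) has_real_derivative laplace_beltrami (\<rho> s) y) (at s)"
        "((\<lambda>s. \<sigma> s y) has_real_derivative laplace_beltrami (\<sigma> s) y) (at s)"
      using \<rho> \<sigma> s0 y by (auto simp: heat_solution_def)
    have "laplace_beltrami (\<lambda>y. \<rho> s y - \<sigma> s y) y \<le> 0"
      by (rule laplace_beltrami_nonpos_at_max[OF laplace_beltrami_diff(1)[OF C y] y])
         (use wmax[OF s] in \<open>auto simp: w_def\<close>)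
    then have "laplace_beltrami (\<rho> s) y - laplace_beltrami (\<sigma> s) y - \<delta> < 0"
      using laplace_beltrami_diff(2)[OF C y] \<delta> by simp
    moreover have "((\<lambda>s. w s y) has_real_derivative laplace_beltrami (\<rho> s) y - laplace_beltrami (\<sigma> s) y - \<delta>) (at s)"
      unfolding w_def by (auto intro!: derivative_eq_intros der)
    \<comment> \<open>The comparison is with earlier times, since \<open>s\<close> may be the final
      time \<open>t\<close>, after which \<open>w\<close> is not controlled by the maximum.\<close>
    ultimately obtain d where d: "d > 0" "\<And>h. 0 < h \<Longrightarrow> h < d \<Longrightarrow> w s y < w (s - h) y"
      using DERIV_neg_dec_left by blast
    define h where "h = min d s / 2"
    have "0 < h" "h < d" "h \<le> s" using d s0 by (auto simp: h_def)
    then show False using d(2)[of h] wmax[of "s - h" y] s y by auto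
  qed
  moreover have "w 0 y = 0" using \<rho> \<sigma> y by (auto simp: heat_solution_def w_def)
  ultimately show "\<rho> t x \<le> \<sigma> t x + e"
    using wmax[of t x] t x \<delta> by (auto simp: w_def)
qed

lemma heat_solution_unique:
  assumes "heat_solution \<rho>0 \<rho>" "heat_solution \<rho>0 \<sigma>" "t \<ge> 0" "x \<in> sphere 0 1"
  shows "\<rho> t x = \<sigma> t x"
  using heat_solution_le[OF assms] heat_solution_le[OF assms(2,1,3,4)] by simp

section \<open>Zonal solutions of degree two\<close>

text \<open>\<open>z\<close> and \<open>z^2 - 1 / (d + 1)\<close> are the zonal spherical harmonics
  of degrees 1 and 2, with eigenvalues \<open>- d\<close> and \<open>- 2 * (d + 1)\<close> of the
  Laplacian.\<close>

lemma heat_solution_quadratic: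
  fixes e :: "'a::euclidean_space" and k0 k1 k2 :: real
  assumes dim: "DIM('a) = d + 1" and e: "norm e = 1"
  defines "u \<equiv> \<lambda>t x. k0 + k1 * exp (- real d * t) * (x \<bullet> e)
      + k2 * exp (- 2 * (real d + 1) * t) * ((x \<bullet> e)\<^sup>2 - 1 / (real d + 1))"
  shows "heat_solution (u 0) u"
proof -
  define A where "A t = k1 * exp (- real d * t)" for t
  define B where "B t = k2 * exp (- 2 * (real d + 1) * t)" for t
  have u: "u t = (\<lambda>x. (k0 - B t / (real d + 1)) + A t * (x \<bullet> e) + B t * (x \<bullet> e)\<^sup>2)" for t
    by (auto simp: u_def A_def B_def algebra_simps)
  have "C_sphere 2 (u t)" for t
    using smooth_sphere_quadratic unfolding u smooth_sphere_def by blast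
  moreover have "((\<lambda>s. u s x) has_real_derivative laplace_beltrami (u t) x) (at t)" if "norm x = 1" for t x
  proof -
    have "laplace_beltrami (u t) x
      = (1 - (x \<bullet> e)\<^sup>2) * (2 * B t) - (real DIM('a) - 1) * (x \<bullet> e) * (A t + 2 * B t * (x \<bullet> e))"
      unfolding u by (rule laplace_beltrami_zonal[OF that e, where g = "\<lambda>z. _ + A t * z + B t * z\<^sup>2"])
        (auto intro!: derivative_eq_intros)
    also have "\<dots> = - real d * A t * (x \<bullet> e) - 2 * (real d + 1) * B t * ((x \<bullet> e)\<^sup>2 - 1 / (real d + 1))"
      by (simp add: dim field_simps power2_eq_square)
    finally show ?thesis
      by (auto intro!: derivative_eq_intros simp: u_def A_def B_def) (simp add: algebra_simps)
  qed
  moreover have "continuous_on ({0..} \<times> sphere 0 1) (\<lambda>(t, x). u t x)"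
    unfolding u_def case_prod_beta by (intro continuous_intros)
  ultimately show ?thesis
    by (simp add: heat_solution_def)
qed

section \<open>Integrals of zonal functions\<close>

lemma sphere_moments:
  fixes e :: "'a::euclidean_space"
  assumes e: "e \<in> Basis" and dim: "DIM('a) \<ge> 2"
  shows "(\<integral>x. x \<bullet> e \<partial>sphere_measure) = 0" "(\<integral>x. (x \<bullet> e)\<^sup>2 \<partial>sphere_measure) = 1 / real DIM('a)"
proof -
  interpret prob_space "sphere_measure :: 'a measure" by (rule prob_space_sphere_measure)
  show "(\<integral>x. x \<bullet> e \<partial>sphere_measure) = 0"
    using sphere_integration_by_parts[OF e, of "\<lambda>_. 1" "\<lambda>_. 0"] dim by simp
  \<comment> \<open>The first moment came from \<open>h = 1\<close>; the second one comes from
    \<open>h z = z\<close>.\<close>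
  have "(\<integral>x. 1 - real DIM('a) * (x \<bullet> e)\<^sup>2 \<partial>sphere_measure) = 0"
    using sphere_integration_by_parts[OF e, of "\<lambda>z. z" "\<lambda>_. 1"]
    by (simp add: algebra_simps power2_eq_square)
  moreover have "integrable sphere_measure (\<lambda>x. (x \<bullet> e)\<^sup>2)"
    by (intro integrable_sphere_measure continuous_intros)
  ultimately show "(\<integral>x. (x \<bullet> e)\<^sup>2 \<partial>sphere_measure) = 1 / real DIM('a)"
    using prob_space dim by (simp add: field_simps)
qed

lemma Basis_inner_sphere:
  assumes "e \<in> Basis" "norm x = 1"
  shows "x \<bullet> e \<in> {-1..1}"
  using Basis_le_norm[OF assms(1), of x] assms(2) by auto

lemma continuous_on_zonal:
  assumes "e \<in> Basis" "continuous_on {-1..1} g"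
  shows "continuous_on (sphere 0 1) (\<lambda>x. g (x \<bullet> e))"
  by (rule continuous_on_compose2[OF assms(2)]) (use Basis_inner_sphere[OF assms(1)] in \<open>auto intro!: continuous_intros\<close>)

text \<open>The integrand is nonnegative; if its integral were \<open>0\<close>, then
  \<open>z^2 = 1\<close> almost everywhere, against the second moment
  \<open>1 / DIM('a) < 1\<close>.\<close>

lemma integral_sphere_zonal_pos:
  fixes e :: "'a::euclidean_space"
  assumes e: "e \<in> Basis" and dim: "DIM('a) \<ge> 2"
    and g: "continuous_on {-1..1} g" "\<And>z. z \<in> {-1..1} \<Longrightarrow> g z > 0"
  shows "(\<integral>x. (1 - (x \<bullet> e)\<^sup>2)\<^sup>2 * g (x \<bullet> e) \<partial>sphere_measure) > 0"
proof -
  interpret prob_space "sphere_measure :: 'a measure" by (rule prob_space_sphere_measure)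
  let ?f = "\<lambda>x. (1 - (x \<bullet> e)\<^sup>2)\<^sup>2 * g (x \<bullet> e)"
  have pos: "g (x \<bullet> e) > 0" if "x \<in> space sphere_measure" for x
    using Basis_inner_sphere[OF e, of x] g(2) that by simp
  have int: "integrable sphere_measure ?f"
    by (intro integrable_sphere_measure continuous_intros continuous_on_zonal[OF e g(1)])
  have nn: "AE x in sphere_measure. 0 \<le> ?f x"
    by (intro AE_I2) (auto intro!: mult_nonneg_nonneg less_imp_le[OF pos])
  have "(\<integral>x. ?f x \<partial>sphere_measure) \<noteq> 0"
  proof
    assume "(\<integral>x. ?f x \<partial>sphere_measure) = 0"
    then have "AE x in sphere_measure. ?f x = 0"
      using integral_nonneg_eq_0_iff_AE[OF int nn] by simp
    then have "AE x in sphere_measure. 1 - (x \<bullet> e)\<^sup>2 = 0"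
      by (rule AE_mp) (auto intro!: AE_I2 dest: pos)
    then have "(\<integral>x. 1 - (x \<bullet> e)\<^sup>2 \<partial>sphere_measure) = (\<integral>x. 0 \<partial>(sphere_measure :: 'a measure))"
      by (intro integral_cong_AE) (auto intro!: borel_measurable_integrable integrable_sphere_measure continuous_intros)
    moreover have "integrable sphere_measure (\<lambda>x. (x \<bullet> e)\<^sup>2)"
      by (intro integrable_sphere_measure continuous_intros)
    ultimately show False
      using sphere_moments[OF e dim] dim prob_space by simp
  qed
  with integral_nonneg_AE[OF nn] show ?thesis by simp
qed

lemma fisher_zonal:
  fixes e :: "'a::euclidean_space"
  assumes e: "e \<in> Basis"
    and g: "\<And>z. z \<in> {-1..1} \<Longrightarrow> g z > 0" "\<And>z. z \<in> {-1..1} \<Longrightarrow> (g has_real_derivative g1 z) (at z)"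
    and \<rho>: "\<And>x. x \<in> sphere 0 1 \<Longrightarrow> \<rho> x = g (x \<bullet> e)"
  shows "fisher p \<rho> = (\<integral>x. (1 / p)\<^sup>2 * ((1 - (x \<bullet> e)\<^sup>2) * (g (x \<bullet> e) powr (2 / p - 2) * (g1 (x \<bullet> e))\<^sup>2)) \<partial>sphere_measure)"
  unfolding fisher_def
proof (rule Bochner_Integration.integral_cong[OF refl])
  fix x :: 'a assume "x \<in> space sphere_measure"
  then have x: "norm x = 1" by simp
  note z = Basis_inner_sphere[OF e x]
  have sq: "(g (x \<bullet> e) powr (1 / p - 1))\<^sup>2 = g (x \<bullet> e) powr (2 / p - 2)"
    by (simp add: power2_eq_square flip: powr_add)
  have "sphere_grad (\<lambda>y. \<rho> y powr (1 / p)) x = sphere_grad (\<lambda>y. g (y \<bullet> e) powr (1 / p)) x"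
    using \<rho> by (intro sphere_grad_cong[OF x]) simp
  also have "(norm \<dots>)\<^sup>2 = (1 / p * g (x \<bullet> e) powr (1 / p - 1) * g1 (x \<bullet> e))\<^sup>2 * (1 - (x \<bullet> e)\<^sup>2)"
    using e by (intro norm_sphere_grad_zonal[OF x, where g = "\<lambda>z. g z powr (1 / p)"])
      (use z g in \<open>auto intro!: derivative_eq_intros simp: powr_diff less_imp_le\<close>)
  finally show "(norm (sphere_grad (\<lambda>y. \<rho> y powr (1 / p)) x))\<^sup>2
      = (1 / p)\<^sup>2 * ((1 - (x \<bullet> e)\<^sup>2) * (g (x \<bullet> e) powr (2 / p - 2) * (g1 (x \<bullet> e))\<^sup>2))"
    by (simp add: power_mult_distrib power_divide mult_ac sq)
qed

text \<open>The algebraic core. Up to the factor \<open>a^2 / 4 * \<rho>^a\<close>, the left side is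
  the time derivative of the integrand of the deficit. The last bracket integrates to zero against
  \<open>\<rho>^a\<close>, and \<open>h'\<close> is the \<open>z\<close>-derivative of
  \<open>h\<close> computed with \<open>r' = s - r^2\<close> and
  \<open>s' = - s * r\<close>.\<close>

lemma carre_du_champ_identity:
  fixes a d z r s k1 k3 \<beta> \<gamma> :: real
  assumes "k1 * (1 - a) = 2 * d" "k3 * (d + 2) = d * (a - 2)"
    "2 * (d + 2) * \<beta> = (2 - a) * (2 * d + 1)" "2 * (d + 2) * \<gamma> = d * (2 - a) * (3 - a)" "d + 2 \<noteq> 0"
    and \<nu>: "\<nu> = 1 - z\<^sup>2" and h: "h = k1 * r + k3 * \<nu> * r ^ 3 + 2 * \<nu> * r * s"
    and h': "h' = k1 * (s - r\<^sup>2) + k3 * (- 2 * z * r ^ 3 + 3 * \<nu> * r\<^sup>2 * (s - r\<^sup>2))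
        + 2 * (- 2 * z * r * s + \<nu> * (s\<^sup>2 - 2 * r\<^sup>2 * s))"
  shows "\<nu> * ((a - 2) * (\<nu> * s - d * z * r) * r\<^sup>2 + 2 * r * (- (d + 2) * z * s - d * r)) + k1 * (\<nu> * s - d * z * r)
    = - 2 * \<nu>\<^sup>2 * (s\<^sup>2 - 2 * \<beta> * s * r\<^sup>2 + \<gamma> * r ^ 4) + (\<nu> * (a * r * h + h') - d * z * h)"
  (is "?L = ?R")
proof -
  \<comment> \<open>The factor \<open>d + 2\<close> clears the denominators of \<open>k3\<close>,
    \<open>\<beta>\<close> and \<open>\<gamma>\<close>, so that the defining relations enter as
    polynomial equations.\<close>
  have "(d + 2) * (?L - ?R) = 0"
    using assms(1-4) unfolding h h' \<nu> by algebra
  then show ?thesis using assms(5) by simp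
qed

section \<open>The deficit along a zonal flow of degree two\<close>

locale quadratic_heat_flow =
  fixes e :: "'a::euclidean_space" and d :: nat and k0 k1 k2 p :: real
  assumes e: "e \<in> Basis" and dim: "DIM('a) = d + 1" and d: "d \<ge> 2" and p: "p > 2"
    and pos: "\<And>t z. t \<ge> 0 \<Longrightarrow> z \<in> {-1..1} \<Longrightarrow>
      k0 + k1 * exp (- real d * t) * z + k2 * exp (- 2 * (real d + 1) * t) * (z\<^sup>2 - 1 / (real d + 1)) > 0"
begin

text \<open>
  \<open>R\<close> is the flow in the variable \<open>z = x \<bullet> e\<close>, \<open>R1\<close> its \<open>z\<close>-derivative, and \<open>Rt\<close>, \<open>R1t\<close>, \<open>Gt\<close> are time
  derivatives. The mass of the solution is \<open>k0\<close>, so up to a constant \<open>G\<close> is the integrand of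
  \<open>\<I>\<^sub>p - d \<E>\<^sub>p\<close>.
\<close>

definition "A t = k1 * exp (- real d * t)"
definition "B t = k2 * exp (- 2 * (real d + 1) * t)"
definition "R t z = k0 + A t * z + B t * (z\<^sup>2 - 1 / (real d + 1))"
definition "R1 t z = A t + 2 * B t * z"
definition "Rt t z = - real d * A t * z - 2 * (real d + 1) * B t * (z\<^sup>2 - 1 / (real d + 1))"
definition "R1t t z = - real d * A t - 4 * (real d + 1) * B t * z"

definition "G t z = (1 / p)\<^sup>2 * ((1 - z\<^sup>2) * (R t z powr (2 / p - 2) * (R1 t z)\<^sup>2))
  + real d / (p - 2) * R t z powr (2 / p)"

definition "Gt t z = (1 / p)\<^sup>2 * ((1 - z\<^sup>2) * ((2 / p - 2) * R t z powr (2 / p - 3) * Rt t z * (R1 t z)\<^sup>2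
    + R t z powr (2 / p - 2) * (2 * R1 t z * R1t t z)))
  + real d / (p - 2) * (2 / p * R t z powr (2 / p - 1) * Rt t z)"

lemma R_pos: "t \<ge> 0 \<Longrightarrow> z \<in> {-1..1} \<Longrightarrow> R t z > 0"
  using pos by (simp add: R_def A_def B_def)

lemma R_deriv_z: "(R t has_real_derivative R1 t z) (at z)"
  unfolding R_def R1_def by (auto intro!: derivative_eq_intros)

lemma R_deriv_t: "((\<lambda>t. R t z) has_real_derivative Rt t z) (at t)"
  unfolding R_def Rt_def A_def B_def by (auto intro!: derivative_eq_intros) (simp add: algebra_simps)

lemma R1_deriv_t: "((\<lambda>t. R1 t z) has_real_derivative R1t t z) (at t)"
  unfolding R1_def R1t_def A_def B_def by (auto intro!: derivative_eq_intros) (simp add: algebra_simps)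

lemma G_deriv_t:
  assumes "t \<ge> 0" "z \<in> {-1..1}"
  shows "((\<lambda>t. G t z) has_real_derivative Gt t z) (at t)"
proof -
  have "R t z > 0" using R_pos assms by simp
  then have P: "((\<lambda>t. R t z powr c) has_real_derivative c * R t z powr (c - 1) * Rt t z) (at t)" for c
    using R_deriv_t by (auto intro!: derivative_eq_intros simp: powr_diff less_imp_le)
  show ?thesis
    unfolding G_def Gt_def
    by (rule derivative_eq_intros P R1_deriv_t refl)+ (simp add: algebra_simps)
qed

lemma continuous_on_R:
  "continuous_on S (\<lambda>x. f x) \<Longrightarrow> continuous_on S g \<Longrightarrow> continuous_on S (\<lambda>x. R (f x) (g x))"
  "continuous_on S (\<lambda>x. f x) \<Longrightarrow> continuous_on S g \<Longrightarrow> continuous_on S (\<lambda>x. R1 (f x) (g x))"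
  "continuous_on S (\<lambda>x. f x) \<Longrightarrow> continuous_on S g \<Longrightarrow> continuous_on S (\<lambda>x. Rt (f x) (g x))"
  "continuous_on S (\<lambda>x. f x) \<Longrightarrow> continuous_on S g \<Longrightarrow> continuous_on S (\<lambda>x. R1t (f x) (g x))"
  unfolding R_def R1_def Rt_def R1t_def A_def B_def by (auto intro!: continuous_intros)

lemma continuous_on_G:
  fixes f g :: "'b::topological_space \<Rightarrow> real"
  assumes f: "continuous_on S f" and g: "continuous_on S g"
    and ran: "\<And>x. x \<in> S \<Longrightarrow> 0 \<le> f x" "\<And>x. x \<in> S \<Longrightarrow> g x \<in> {-1..1}"
  shows "continuous_on S (\<lambda>x. G (f x) (g x))" "continuous_on S (\<lambda>x. Gt (f x) (g x))"
proof -
  have pow: "continuous_on S (\<lambda>x. R (f x) (g x) powr c)" for c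
  proof (rule continuous_on_powr[OF continuous_on_R(1)[OF f g] continuous_on_const])
    show "\<forall>x\<in>S. R (f x) (g x) \<noteq> 0"
      using R_pos[OF ran] by (metis less_irrefl)
  qed
  note rules = continuous_on_add continuous_on_mult continuous_on_diff continuous_on_power continuous_on_const
    pow continuous_on_R[OF f g] f g
  show "continuous_on S (\<lambda>x. G (f x) (g x))"
    unfolding G_def by (intro rules)
  show "continuous_on S (\<lambda>x. Gt (f x) (g x))"
    unfolding Gt_def by (intro rules)
qed

lemma heat_solution_eq:
  assumes "heat_solution (\<lambda>x. R 0 (x \<bullet> e)) \<sigma>" "t \<ge> 0" "x \<in> sphere 0 1"
  shows "\<sigma> t x = R t (x \<bullet> e)"
proof -
  have "heat_solution (\<lambda>x. R 0 (x \<bullet> e)) (\<lambda>t x. R t (x \<bullet> e))"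
    using heat_solution_quadratic[OF dim, of e k0 k1 k2] e by (simp add: R_def A_def B_def)
  from heat_solution_unique[OF assms(1) this assms(2,3)] show ?thesis .
qed

text \<open>The harmonics of degrees 1 and 2 have mean zero, so the mass stays equal to
  \<open>k0\<close> and its power in the entropy is constant in time.\<close>

lemma deficit_eq:
  assumes \<sigma>: "heat_solution (\<lambda>x. R 0 (x \<bullet> e)) \<sigma>" and t: "t \<ge> 0"
  shows "fisher p (\<sigma> t) - real d * entropy p (\<sigma> t)
    = (\<integral>x. G t (x \<bullet> e) \<partial>sphere_measure) - real d / (p - 2) * k0 powr (2 / p)"
proof -
  interpret prob_space "sphere_measure :: 'a measure" by (rule prob_space_sphere_measure)
  note eq = heat_solution_eq[OF \<sigma> t]
  have cpow: "continuous_on {-1..1} (\<lambda>z. R t z powr c)" for c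
    using R_pos[OF t] by (intro continuous_on_powr continuous_on_R continuous_intros) force
  have i: "integrable sphere_measure (\<lambda>x. x \<bullet> e)" "integrable sphere_measure (\<lambda>x. (x \<bullet> e)\<^sup>2)"
    by (intro integrable_sphere_measure continuous_intros)+
  have "(\<integral>x. \<sigma> t x \<partial>sphere_measure) = (\<integral>x. R t (x \<bullet> e) \<partial>sphere_measure)"
    using eq by (intro Bochner_Integration.integral_cong) auto
  also have "\<dots> = k0"
    unfolding R_def using sphere_moments[OF e] dim d i prob_space by (simp add: algebra_simps)
  finally have mass: "(\<integral>x. \<sigma> t x \<partial>sphere_measure) = k0" .
  have pow: "(\<integral>x. \<sigma> t x powr (2 / p) \<partial>sphere_measure) = (\<integral>x. R t (x \<bullet> e) powr (2 / p) \<partial>sphere_measure)"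
    using eq by (intro Bochner_Integration.integral_cong) auto
  have "fisher p (\<sigma> t) = (\<integral>x. (1 / p)\<^sup>2 * ((1 - (x \<bullet> e)\<^sup>2) * (R t (x \<bullet> e) powr (2 / p - 2) * (R1 t (x \<bullet> e))\<^sup>2)) \<partial>sphere_measure)"
    by (rule fisher_zonal[OF e R_pos[OF t] R_deriv_z eq])
  moreover have "(\<integral>x. G t (x \<bullet> e) \<partial>sphere_measure)
    = (\<integral>x. (1 / p)\<^sup>2 * ((1 - (x \<bullet> e)\<^sup>2) * (R t (x \<bullet> e) powr (2 / p - 2) * (R1 t (x \<bullet> e))\<^sup>2)) \<partial>sphere_measure)
      + (\<integral>x. real d / (p - 2) * R t (x \<bullet> e) powr (2 / p) \<partial>sphere_measure)"
    unfolding G_def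
    by (intro Bochner_Integration.integral_add integrable_sphere_measure continuous_intros continuous_on_R
        continuous_on_zonal[OF e cpow])
  ultimately show ?thesis
    unfolding Defs.entropy_def mass pow by (simp add: right_diff_distrib diff_divide_distrib)
qed

lemma deficit_deriv:
  assumes \<sigma>: "heat_solution (\<lambda>x. R 0 (x \<bullet> e)) \<sigma>"
  shows "((\<lambda>t. fisher p (\<sigma> t) - real d * entropy p (\<sigma> t)) has_real_derivative
    (\<integral>x. Gt 0 (x \<bullet> e) \<partial>sphere_measure)) (at 0 within {0..})"
proof -
  have z: "x \<bullet> e \<in> {-1..1}" if "x \<in> sphere 0 1" for x using Basis_inner_sphere[OF e] that by simp
  have "((\<lambda>t. \<integral>x. G t (x \<bullet> e) \<partial>sphere_measure) has_real_derivative
      (\<integral>x. Gt 0 (x \<bullet> e) \<partial>sphere_measure)) (at 0 within {0..1})"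
  proof (rule has_real_derivative_integral_sphere_measure[where G = "\<lambda>t x. G t (x \<bullet> e)" and G' = "\<lambda>t x. Gt t (x \<bullet> e)"])
    show "((\<lambda>s. G s (x \<bullet> e)) has_real_derivative Gt t (x \<bullet> e)) (at t within {0..1})"
      if "t \<in> {0..1}" "x \<in> sphere 0 1" for t x
      using that z by (intro has_field_derivative_at_within[OF G_deriv_t]) auto
    show "continuous_on (sphere 0 1) (\<lambda>x. G t (x \<bullet> e))" if "t \<in> {0..1}" for t
      using that z by (intro continuous_on_G(1) continuous_intros) auto
    show "continuous_on ({0..1} \<times> sphere 0 1) (\<lambda>(t, x). Gt t (x \<bullet> e))"
      unfolding case_prod_beta using z by (intro continuous_on_G(2) continuous_intros) auto
  qed auto
  \<comment> \<open>The compact interval served the differentiation under the integral; near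
    \<open>0\<close> it coincides with the half-line.\<close>
  moreover have "at (0::real) within {0..1} = at 0 within {0..}"
    by (rule at_within_nhd[of _ "{..<1}"]) auto
  ultimately have "((\<lambda>t. (\<integral>x. G t (x \<bullet> e) \<partial>sphere_measure) - real d / (p - 2) * k0 powr (2 / p)) has_real_derivative
      (\<integral>x. Gt 0 (x \<bullet> e) \<partial>sphere_measure)) (at 0 within {0..})"
    by (auto intro!: derivative_eq_intros)
  then show ?thesis
    by (rule has_field_derivative_transform_within[where d = 1]) (auto simp: deficit_eq[OF \<sigma>])
qed

text \<open>Pointwise, \<open>Gt 0\<close> is the integrand on the right plus
  \<open>(1 - z^2) * h' - d * z * h\<close>, which integrates to zero by
  \<open>sphere_integration_by_parts\<close>. In \<open>Q\<close>, \<open>2 * k2\<close> is the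
  second \<open>z\<close>-derivative of \<open>R 0\<close>.\<close>

lemma integral_Gt_eq:
  fixes a \<beta> \<gamma> :: real
  assumes a: "a = 2 / p"
    and \<beta>: "2 * (real d + 2) * \<beta> = (2 - a) * (2 * real d + 1)" and \<gamma>: "2 * (real d + 2) * \<gamma> = real d * (2 - a) * (3 - a)"
  defines "Q \<equiv> \<lambda>z. (2 * k2 / R 0 z)\<^sup>2 - 2 * \<beta> * (2 * k2 / R 0 z) * (R1 0 z / R 0 z)\<^sup>2 + \<gamma> * (R1 0 z / R 0 z) ^ 4"
  shows "(\<integral>x. Gt 0 (x \<bullet> e) \<partial>sphere_measure)
    = (\<integral>x. (1 - (x \<bullet> e)\<^sup>2)\<^sup>2 * (a\<^sup>2 / 2 * R 0 (x \<bullet> e) powr a * - Q (x \<bullet> e)) \<partial>sphere_measure)"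
proof -
  have a01: "0 < a" "a < 1" using p by (auto simp: a)
  define P where "P z = R 0 z powr a" for z
  define r where "r z = R1 0 z / R 0 z" for z
  define s where "s z = 2 * k2 / R 0 z" for z
  \<comment> \<open>\<open>H\<close> bundles three integrations by parts; \<open>c1\<close> and \<open>c3\<close> are the coefficients for which everything
    that is not a multiple of \<open>\<nu>\<^sup>2\<close> cancels.\<close>
  define c1 where "c1 = 2 * real d / (1 - a)"
  define c3 where "c3 = real d * (a - 2) / (real d + 2)"
  define H where "H z = c1 * r z + c3 * (1 - z\<^sup>2) * r z ^ 3 + 2 * (1 - z\<^sup>2) * r z * s z" for z
  define H' where "H' z = c1 * (s z - (r z)\<^sup>2) + c3 * (- 2 * z * r z ^ 3 + 3 * (1 - z\<^sup>2) * (r z)\<^sup>2 * (s z - (r z)\<^sup>2))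
        + 2 * (- 2 * z * r z * s z + (1 - z\<^sup>2) * ((s z)\<^sup>2 - 2 * (r z)\<^sup>2 * s z))" for z
  define h where "h z = a\<^sup>2 / 4 * (P z * H z)" for z
  define h' where "h' z = a\<^sup>2 / 4 * (P z * (a * r z * H z + H' z))" for z
  have R0: "R 0 z > 0" if "z \<in> {-1..1}" for z using R_pos[of 0] that by simp
  have R1': "(R1 0 has_real_derivative 2 * k2) (at z)" for z
    unfolding R1_def A_def B_def by (auto intro!: derivative_eq_intros)
  have r': "(r has_real_derivative s z - (r z)\<^sup>2) (at z)" if "z \<in> {-1..1}" for z
    unfolding r_def s_def using R0[OF that]
    by (auto intro!: derivative_eq_intros R1' R_deriv_z simp: field_simps power2_eq_square)
  have s': "(s has_real_derivative - s z * r z) (at z)" if "z \<in> {-1..1}" for z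
    unfolding r_def s_def using R0[OF that]
    by (auto intro!: derivative_eq_intros R_deriv_z simp: field_simps power2_eq_square)
  have P': "(P has_real_derivative a * r z * P z) (at z)" if "z \<in> {-1..1}" for z
    unfolding P_def r_def using R0[OF that]
    by (auto intro!: derivative_eq_intros R_deriv_z simp: powr_diff less_imp_le)
  have H': "(H has_real_derivative H' z) (at z)" if "z \<in> {-1..1}" for z
    unfolding H_def H'_def
    by (rule derivative_eq_intros r'[OF that] s'[OF that] refl)+ (simp add: algebra_simps power2_eq_square power3_eq_cube)
  have h_deriv: "(h has_real_derivative h' z) (at z)" if "z \<in> {-1..1}" for z
    unfolding h_def h'_def
    by (rule derivative_eq_intros P'[OF that] H'[OF that] refl)+ (simp add: algebra_simps)
  have cr: "continuous_on {-1..1} r" "continuous_on {-1..1} s" "continuous_on {-1..1} P"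
    by (rule DERIV_continuous_on, rule has_field_derivative_at_within, rule r' s' P', assumption)+
  have ch': "continuous_on {-1..1} h'" and ch: "continuous_on {-1..1} h"
    unfolding h_def h'_def H_def H'_def by (intro continuous_intros cr)+
  let ?N = "\<lambda>z. (1 - z\<^sup>2)\<^sup>2 * (a\<^sup>2 / 2 * P z * - Q z)"
  have Qe: "Q z = (s z)\<^sup>2 - 2 * \<beta> * s z * (r z)\<^sup>2 + \<gamma> * r z ^ 4" for z
    by (simp add: Q_def s_def r_def)
  have cN: "continuous_on {-1..1} ?N"
    unfolding Qe by (intro continuous_intros cr)
  have eq: "Gt 0 z = ?N z + ((1 - z\<^sup>2) * h' z - real d * z * h z)" if z: "z \<in> {-1..1}" for z
  proof -
    note R = R0[OF z]
    have e1: "R1 0 z = R 0 z * r z" "2 * k2 = R 0 z * s z"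
      using R by (auto simp: r_def s_def)
    \<comment> \<open>This is the zonal heat equation
      \<open>Rt = (1 - z^2) * R'' - d * z * R'\<close> divided by \<open>R\<close>;
      \<open>e3\<close> is its \<open>z\<close>-derivative, where \<open>R''' = 0\<close> because
      \<open>R\<close> is quadratic.\<close>
    have e2: "Rt 0 z = R 0 z * ((1 - z\<^sup>2) * s z - d * z * r z)"
    proof -
      have "Rt 0 z = (1 - z\<^sup>2) * (2 * k2) - d * z * R1 0 z"
        by (simp add: Rt_def R1_def A_def B_def field_simps power2_eq_square)
      then show ?thesis unfolding e1 by (simp add: algebra_simps)
    qed
    have e3: "R1t 0 z = R 0 z * (- (real d + 2) * z * s z - d * r z)"
    proof -
      have "R1t 0 z = - (real d + 2) * z * (2 * k2) - d * R1 0 z"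
        by (simp add: R1t_def R1_def A_def B_def field_simps)
      then show ?thesis unfolding e1 by (simp add: algebra_simps)
    qed
    have pw: "R 0 z powr (a - 2) = P z / (R 0 z)\<^sup>2" "R 0 z powr (a - 3) = P z / R 0 z ^ 3" "R 0 z powr (a - 1) = P z / R 0 z"
      using R by (auto simp: P_def powr_diff)
    \<comment> \<open>As \<open>p - 2 = 2 * (1 - a) / a\<close>, the entropy term enters with
      exactly the coefficient \<open>c1\<close> of \<open>H\<close>.\<close>
    have dp: "real d / (p - 2) * a = a\<^sup>2 / 4 * c1"
      using p by (simp add: a c1_def field_simps power2_eq_square)
    have "Gt 0 z = (a / 2)\<^sup>2 * ((1 - z\<^sup>2) * ((a - 2) * (P z / R 0 z ^ 3) * (R 0 z * ((1 - z\<^sup>2) * s z - d * z * r z)) * (R 0 z * r z)\<^sup>2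
      + (P z / (R 0 z)\<^sup>2) * (2 * (R 0 z * r z) * (R 0 z * (- (real d + 2) * z * s z - d * r z)))))
      + real d / (p - 2) * a * (P z / R 0 z) * (R 0 z * ((1 - z\<^sup>2) * s z - d * z * r z))"
      using p unfolding Gt_def e2 e3 e1(1) unfolding a[symmetric] pw by (simp add: a mult_ac)
    also have "\<dots> = a\<^sup>2 / 4 * (P z * ((1 - z\<^sup>2) * ((a - 2) * ((1 - z\<^sup>2) * s z - d * z * r z) * (r z)\<^sup>2 + 2 * r z * (- (real d + 2) * z * s z - d * r z))
        + c1 * ((1 - z\<^sup>2) * s z - d * z * r z)))"
      unfolding dp using R by (simp add: power2_eq_square power3_eq_cube field_simps)
    also have "(1 - z\<^sup>2) * ((a - 2) * ((1 - z\<^sup>2) * s z - d * z * r z) * (r z)\<^sup>2 + 2 * r z * (- (real d + 2) * z * s z - d * r z))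
        + c1 * ((1 - z\<^sup>2) * s z - d * z * r z)
      = - 2 * (1 - z\<^sup>2)\<^sup>2 * ((s z)\<^sup>2 - 2 * \<beta> * s z * (r z)\<^sup>2 + \<gamma> * r z ^ 4) + ((1 - z\<^sup>2) * (a * r z * H z + H' z) - d * z * H z)"
      using a01 by (intro carre_du_champ_identity[OF _ _ \<beta> \<gamma> _ refl H_def H'_def]) (auto simp: c1_def c3_def)
    finally have "Gt 0 z = a\<^sup>2 / 4 * (P z * (- 2 * (1 - z\<^sup>2)\<^sup>2 * Q z + ((1 - z\<^sup>2) * (a * r z * H z + H' z) - d * z * H z)))"
      unfolding Qe .
    also have "\<dots> = ?N z + ((1 - z\<^sup>2) * h' z - real d * z * h z)"
      unfolding h_def h'_def by (simp add: field_simps)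
    finally show ?thesis .
  qed
  have "(\<integral>x. Gt 0 (x \<bullet> e) \<partial>sphere_measure)
    = (\<integral>x. ?N (x \<bullet> e) + ((1 - (x \<bullet> e)\<^sup>2) * h' (x \<bullet> e) - (real DIM('a) - 1) * (x \<bullet> e) * h (x \<bullet> e)) \<partial>sphere_measure)"
    using eq Basis_inner_sphere[OF e] by (intro Bochner_Integration.integral_cong) (auto simp: dim)
  also have "\<dots> = (\<integral>x. ?N (x \<bullet> e) \<partial>sphere_measure)
      + (\<integral>x. (1 - (x \<bullet> e)\<^sup>2) * h' (x \<bullet> e) - (real DIM('a) - 1) * (x \<bullet> e) * h (x \<bullet> e) \<partial>sphere_measure)"
    by (intro Bochner_Integration.integral_add integrable_sphere_measure continuous_on_zonal[OF e cN]
      continuous_intros continuous_on_zonal[OF e ch'] continuous_on_zonal[OF e ch])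
  also have "(\<integral>x. (1 - (x \<bullet> e)\<^sup>2) * h' (x \<bullet> e) - (real DIM('a) - 1) * (x \<bullet> e) * h (x \<bullet> e) \<partial>sphere_measure) = 0"
    by (rule sphere_integration_by_parts[OF e h_deriv ch'])
  finally show ?thesis by (simp add: P_def)
qed

end

section \<open>The choice of the initial datum\<close>

text \<open>At the critical exponent the claim is \<open>two_sharp d < two_star d\<close>; after
  cross-multiplication the two sides differ by \<open>d + 2\<close>.\<close>

lemma two_sharp_less:
  assumes "(two_sharp d < p \<and> ereal p < two_star d) \<or> (d \<ge> 3 \<and> ereal p = two_star d)"
  shows "two_sharp d < p"
  using assms
proof (elim disjE conjE)
  assume d: "d \<ge> 3" and "ereal p = two_star d"
  then have p: "p = 2 * real d / (real d - 2)" by (simp add: two_star_def)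
  have "(2 * (real d)\<^sup>2 + 1) * (real d - 2) < 2 * real d * (real d - 1)\<^sup>2"
    by (simp add: power2_eq_square algebra_simps)
  then show ?thesis
    using d by (simp add: two_sharp_def p divide_simps)
qed

text \<open>Expanding gives \<open>4 * (d + 2)^2 * (\<beta>^2 - \<gamma>) = (2 - a) * (2 * (d - 1)^2
  - a * (2 * d^2 + 1))\<close>, and with \<open>a = 2 / p\<close> the last factor is positive
  exactly when \<open>p\<close> exceeds \<open>two_sharp d\<close>. That \<open>p > 2\<close>
  follows from \<open>two_sharp d > 2\<close>.\<close>

lemma discriminant_pos:
  fixes d p a \<beta> \<gamma> :: real
  assumes d: "d \<ge> 2" and p: "(2 * d\<^sup>2 + 1) / (d - 1)\<^sup>2 < p"
    and a: "a = 2 / p" and \<beta>: "2 * (d + 2) * \<beta> = (2 - a) * (2 * d + 1)"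
    and \<gamma>: "2 * (d + 2) * \<gamma> = d * (2 - a) * (3 - a)"
  shows "p > 2" "\<beta> > 0" "\<gamma> < \<beta>\<^sup>2"
proof -
  have d1: "(d - 1)\<^sup>2 > 0" using d by simp
  have "2 * (d - 1)\<^sup>2 < 2 * d\<^sup>2 + 1"
    using d by (simp add: power2_eq_square algebra_simps)
  then have "2 < (2 * d\<^sup>2 + 1) / (d - 1)\<^sup>2"
    using d1 by (simp add: field_simps)
  with p show p2: "p > 2" by simp
  then have a01: "0 < a" "a < 1" by (auto simp: a)
  show "\<beta> > 0"
    using \<beta> d a01 zero_less_mult_pos[of "2 * (d + 2)" \<beta>] by simp
  have ap: "a * p = 2" using p2 by (simp add: a)
  have "2 * d\<^sup>2 + 1 < p * (d - 1)\<^sup>2"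
    using p d1 by (simp add: field_simps)
  then have "a * (2 * d\<^sup>2 + 1) < a * (p * (d - 1)\<^sup>2)" using a01 by simp
  also have "\<dots> = 2 * (d - 1)\<^sup>2" unfolding mult.assoc[symmetric] ap ..
  finally have "2 * d * (d + 2) * (3 - a) < (2 - a) * (2 * d + 1)\<^sup>2"
    by (simp add: power2_eq_square algebra_simps)
  then have "(2 - a) * (2 * d * (d + 2) * (3 - a)) < (2 - a) * ((2 - a) * (2 * d + 1)\<^sup>2)"
    using a01 by simp
  also have "\<dots> = (2 * (d + 2) * \<beta>)\<^sup>2" unfolding \<beta> by (simp add: power2_eq_square)
  also have "(2 - a) * (2 * d * (d + 2) * (3 - a)) = 4 * (d + 2)\<^sup>2 * \<gamma>"
    using \<gamma> by algebra
  also have "(2 * (d + 2) * \<beta>)\<^sup>2 = 4 * (d + 2)\<^sup>2 * \<beta>\<^sup>2"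
    by (simp only: power_mult_distrib) simp
  finally show "\<gamma> < \<beta>\<^sup>2"
    by (rule mult_left_less_imp_less) simp
qed

text \<open>
  With \<open>\<rho> = q (\<epsilon> z)\<close>, \<open>q y = 1 + y + \<beta> / 2 y\<^sup>2\<close>, the form \<open>s\<^sup>2 - 2 \<beta> s r\<^sup>2 + \<gamma> r\<^sup>4\<close> is \<open>(\<epsilon> / q)\<^sup>4\<close> times the
  expression below at \<open>y = \<epsilon> z\<close>, whose value at \<open>0\<close> is \<open>\<gamma> - \<beta>\<^sup>2\<close>.
\<close>

lemma exists_negative_profile:
  fixes \<beta> \<gamma> :: real
  assumes "\<gamma> < \<beta>\<^sup>2"
  obtains \<epsilon> where "0 < \<epsilon>" "\<epsilon> < 1"
    "\<And>y. \<bar>y\<bar> \<le> \<epsilon> \<Longrightarrow> \<beta>\<^sup>2 * (1 + y + \<beta> / 2 * y\<^sup>2)\<^sup>2 - 2 * \<beta> * \<beta> * (1 + y + \<beta> / 2 * y\<^sup>2) * (1 + \<beta> * y)\<^sup>2 + \<gamma> * (1 + \<beta> * y) ^ 4 < 0"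
proof -
  define q where "q y = \<beta>\<^sup>2 * (1 + y + \<beta> / 2 * y\<^sup>2)\<^sup>2 - 2 * \<beta> * \<beta> * (1 + y + \<beta> / 2 * y\<^sup>2) * (1 + \<beta> * y)\<^sup>2 + \<gamma> * (1 + \<beta> * y) ^ 4" for y
  have "isCont q 0" unfolding q_def by (intro continuous_intros)
  moreover have "q 0 < 0" using assms by (simp add: q_def power2_eq_square)
  ultimately have "eventually (\<lambda>y. q y < 0) (nhds 0)"
    unfolding isCont_def tendsto_at_iff_tendsto_nhds by (rule order_tendstoD(2))
  then obtain r where r: "r > 0" "\<And>y. \<bar>y\<bar> < r \<Longrightarrow> q y < 0"
    by (auto simp: eventually_nhds_metric dist_real_def)
  show thesis
    by (rule that[of "min r 1 / 2"]) (use r in \<open>auto simp: q_def\<close>)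
qed

theorem proposition2p1:
  fixes d :: nat and p :: real
  assumes dim: "DIM('a::euclidean_space) = d + 1"
    and d: "d \<ge> 2"
    and p: "(two_sharp d < p \<and> ereal p < two_star d) \<or> (d \<ge> 3 \<and> ereal p = two_star d)"
  shows "\<exists>\<rho>0 :: 'a \<Rightarrow> real.
           smooth_sphere \<rho>0 \<and> (\<forall>x\<in>sphere 0 1. \<rho>0 x > 0) \<and>
           (\<exists>\<rho>. heat_solution \<rho>0 \<rho>) \<and>
           (\<forall>\<rho>. heat_solution \<rho>0 \<rho> \<longrightarrow>
              (\<exists>D>0. ((\<lambda>t. fisher p (\<rho> t) - real d * entropy p (\<rho> t))
                        has_real_derivative D) (at 0 within {0..})))"
proof -
  obtain e :: 'a where e: "e \<in> Basis" using nonempty_Basis by blast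
  define a where "a = 2 / p"
  define \<beta> where "\<beta> = (2 - a) * (2 * real d + 1) / (2 * (real d + 2))"
  define \<gamma> where "\<gamma> = real d * (2 - a) * (3 - a) / (2 * (real d + 2))"
  have \<beta>: "2 * (real d + 2) * \<beta> = (2 - a) * (2 * real d + 1)"
    and \<gamma>: "2 * (real d + 2) * \<gamma> = real d * (2 - a) * (3 - a)"
    by (simp_all add: \<beta>_def \<gamma>_def)
  have "real d \<ge> 2" "(2 * (real d)\<^sup>2 + 1) / (real d - 1)\<^sup>2 < p"
    using two_sharp_less[OF p] d by (auto simp: two_sharp_def)
  note disc = discriminant_pos[OF this a_def \<beta> \<gamma>]
  obtain \<epsilon> where \<epsilon>: "0 < \<epsilon>" "\<epsilon> < 1" and neg: "\<And>y. \<bar>y\<bar> \<le> \<epsilon> \<Longrightarrow>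
      \<beta>\<^sup>2 * (1 + y + \<beta> / 2 * y\<^sup>2)\<^sup>2 - 2 * \<beta> * \<beta> * (1 + y + \<beta> / 2 * y\<^sup>2) * (1 + \<beta> * y)\<^sup>2 + \<gamma> * (1 + \<beta> * y) ^ 4 < 0"
    using exists_negative_profile[OF disc(3)] by blast
  define k where "k = \<beta> / 2 * \<epsilon>\<^sup>2"
  have k: "k > 0" using disc \<epsilon> by (simp add: k_def)
  \<comment> \<open>The summand \<open>k / (d + 1)\<close> in the mass offsets the mean subtracted
    from \<open>z^2\<close>, so that \<open>R 0 z = 1 + \<epsilon> * z + k * z^2\<close>. Later the
    offset can only outweigh the decayed subtraction, and the linear term stays above
    \<open>- \<epsilon> > -1\<close>, so the flow remains positive.\<close>
  interpret quadratic_heat_flow e d "1 + k / (real d + 1)" \<epsilon> k p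
  proof
    fix t z :: real assume t: "t \<ge> 0" and z: "z \<in> {-1..1}"
    have E: "exp (- real d * t) \<le> 1" "exp (- 2 * (real d + 1) * t) \<le> 1"
      using t by (auto intro!: mult_nonpos_nonneg)
    have "\<bar>\<epsilon> * exp (- real d * t) * z\<bar> \<le> \<epsilon> * 1 * 1"
      unfolding abs_mult using z E \<epsilon> by (intro mult_mono) auto
    moreover have "k * exp (- 2 * (real d + 1) * t) * z\<^sup>2 \<ge> 0" using k by simp
    moreover have "k * exp (- 2 * (real d + 1) * t) / (real d + 1) \<le> k / (real d + 1)"
      using mult_left_mono[OF E(2), of k] k by (intro divide_right_mono) auto
    ultimately show "1 + k / (real d + 1) + \<epsilon> * exp (- real d * t) * z
        + k * exp (- 2 * (real d + 1) * t) * (z\<^sup>2 - 1 / (real d + 1)) > 0"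
      using \<epsilon> by (simp add: right_diff_distrib)
  qed (use e dim d disc in auto)
  define Q where "Q z = (2 * k / R 0 z)\<^sup>2 - 2 * \<beta> * (2 * k / R 0 z) * (R1 0 z / R 0 z)\<^sup>2 + \<gamma> * (R1 0 z / R 0 z) ^ 4" for z
  have R0: "R 0 z = 1 + \<epsilon> * z + \<beta> / 2 * (\<epsilon> * z)\<^sup>2" for z
  proof -
    have "R 0 z = 1 + \<epsilon> * z + k * z\<^sup>2"
      by (simp add: R_def A_def B_def right_diff_distrib)
    then show ?thesis by (simp add: k_def power_mult_distrib)
  qed
  have R10: "R1 0 z = \<epsilon> * (1 + \<beta> * (\<epsilon> * z))" for z
  proof -
    have "R1 0 z = \<epsilon> + 2 * k * z"
      by (simp add: R1_def A_def B_def)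
    then show ?thesis by (simp add: k_def power2_eq_square algebra_simps)
  qed
  have Q: "Q z < 0" if z: "z \<in> {-1..1}" for z
  proof -
    let ?R = "R 0 z" and ?u = "1 + \<beta> * (\<epsilon> * z)"
    have R: "?R > 0" using R_pos[of 0 z] z by simp
    have "Q z = (\<epsilon> / ?R) ^ 4 * (\<beta>\<^sup>2 * ?R\<^sup>2 - 2 * \<beta> * \<beta> * ?R * ?u\<^sup>2 + \<gamma> * ?u ^ 4)"
    proof -
      have k2: "2 * k = \<beta> * \<epsilon>\<^sup>2"
        by (simp add: k_def)
      have eq: "(\<beta> * \<epsilon>\<^sup>2 / T)\<^sup>2 - 2 * \<beta> * (\<beta> * \<epsilon>\<^sup>2 / T) * (\<epsilon> * u / T)\<^sup>2 + \<gamma> * (\<epsilon> * u / T) ^ 4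
        = (\<epsilon> / T) ^ 4 * (\<beta>\<^sup>2 * T\<^sup>2 - 2 * \<beta> * \<beta> * T * u\<^sup>2 + \<gamma> * u ^ 4)" if "T > 0" for T u :: real
        using that by (simp add: field_simps power2_eq_square power4_eq_xxxx)
      show ?thesis unfolding Q_def R10 k2 by (rule eq[OF R])
    qed
    \<comment> \<open>For \<open>z\<close> in \<open>{-1..1}\<close> the argument
      \<open>\<epsilon> * z\<close> stays in the range where the profile is negative, so the sign
      holds on the whole sphere.\<close>
    moreover have "\<bar>\<epsilon> * z\<bar> \<le> \<epsilon> * 1"
      unfolding abs_mult using z \<epsilon> by (intro mult_mono) auto
    then have "\<beta>\<^sup>2 * ?R\<^sup>2 - 2 * \<beta> * \<beta> * ?R * ?u\<^sup>2 + \<gamma> * ?u ^ 4 < 0"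
      unfolding R0 by (intro neg) simp
    ultimately show ?thesis using R \<epsilon> by (simp add: mult_pos_neg)
  qed
  have "(\<integral>x. Gt 0 (x \<bullet> e) \<partial>sphere_measure)
    = (\<integral>x. (1 - (x \<bullet> e)\<^sup>2)\<^sup>2 * (a\<^sup>2 / 2 * R 0 (x \<bullet> e) powr a * - Q (x \<bullet> e)) \<partial>sphere_measure)"
    unfolding Q_def by (rule integral_Gt_eq[OF a_def \<beta> \<gamma>])
  also have "\<dots> > 0"
  proof (rule integral_sphere_zonal_pos[OF e])
    have R: "R 0 z > 0" if "z \<in> {-1..1}" for z using R_pos[of 0] that by simp
    have "continuous_on {-1..1} (R 0)" "continuous_on {-1..1} (R1 0)"
      using continuous_on_R[OF continuous_on_const continuous_on_id] by auto
    then show "continuous_on {-1..1} (\<lambda>z. a\<^sup>2 / 2 * R 0 z powr a * - Q z)"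
      unfolding Q_def using R by (intro continuous_intros) force+
    show "a\<^sup>2 / 2 * R 0 z powr a * - Q z > 0" if "z \<in> {-1..1}" for z
      using Q[OF that] R[OF that] disc(1) by (intro mult_pos_pos) (auto simp: a_def)
  qed (use dim d in auto)
  finally have D: "(\<integral>x. Gt 0 (x \<bullet> e) \<partial>sphere_measure) > 0" .
  show ?thesis
  proof (intro exI[of _ "\<lambda>x. R 0 (x \<bullet> e)"] conjI ballI allI impI)
    show "smooth_sphere (\<lambda>x. R 0 (x \<bullet> e))"
      unfolding R0 using smooth_sphere_quadratic[of 1 \<epsilon> e "\<beta> / 2 * \<epsilon>\<^sup>2"] by (simp add: power_mult_distrib mult_ac)
    show "R 0 (x \<bullet> e) > 0" if "x \<in> sphere 0 1" for x
      using R_pos[of 0] Basis_inner_sphere[OF e, of x] that by simp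
    show "\<exists>\<rho>. heat_solution (\<lambda>x. R 0 (x \<bullet> e)) \<rho>"
      using heat_solution_quadratic[OF dim, of e "1 + k / (real d + 1)" \<epsilon> k] e
      by (auto simp: R_def A_def B_def)
    show "\<exists>D>0. ((\<lambda>t. fisher p (\<rho> t) - real d * entropy p (\<rho> t)) has_real_derivative D) (at 0 within {0..})"
      if "heat_solution (\<lambda>x. R 0 (x \<bullet> e)) \<rho>" for \<rho>
      using deficit_deriv[OF that] D by blast
  qed
qed

end
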